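(* Let $A=\mathbb C[z_1^{\pm1},\dots,z_m^{\pm1},1/R(z)]$ and let $\widetilde{\mathcal I}^*$ be the ideal of $A[\xi_1,\dots,\xi_m]$ generated by $$\widetilde L_k=(z_k\xi_k)^p-z_k^p\Big(\sum_{j=1}^m z_j\xi_j\Big)^p,\qquad k=1,\dots,m.$$ Then $A[\xi_1,\dots,\xi_m]/\widetilde{\mathcal I}^*$ is a locally free $A$-module of rank $p^m$.
   Context: $R(z)=\prod_{(i_1,\dots,i_m)\in\{1,\dots,p\}^m}(1-\zeta_p^{i_1}z_1-\cdots-\zeta_p^{i_m}z_m)$, $\zeta_p=\exp(2\pi\sqrt{-1}/p)$, $p\ge2$, $m\ge1$. *)

theory Defs
  imports Complex_Main "HOL-Library.FuncSet"
begin

text \<open>Points z = (z_1,...,z_m) are functions nat => complex; coordinate j (0-based, j < m)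
  stands for z_(j+1). All functions below only depend on the coordinates below m.\<close>

definition zeta :: "nat \<Rightarrow> complex" where
  "zeta p = exp (2 * of_real pi * \<i> / of_nat p)"

definition Rpoly :: "nat \<Rightarrow> nat \<Rightarrow> (nat \<Rightarrow> complex) \<Rightarrow> complex" where
  "Rpoly p m z = (\<Prod>t \<in> PiE {..<m} (\<lambda>_. {1..p}). 1 - (\<Sum>j<m. zeta p ^ t j * z j))"

definition poly_fun :: "nat \<Rightarrow> ((nat \<Rightarrow> complex) \<Rightarrow> complex) \<Rightarrow> bool" where
  "poly_fun m g \<longleftrightarrow> (\<exists>S c. finite S \<and>
      (\<forall>z. g z = (\<Sum>\<alpha>\<in>S. c \<alpha> * (\<Prod>i<m. z i ^ \<alpha> i))))"

text \<open>The open set U_f = {z in (C^*)^m : R(z) \<noteq> 0, f(z) \<noteq> 0}; Spec A = U_1.\<close>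
definition Dom :: "nat \<Rightarrow> nat \<Rightarrow> ((nat \<Rightarrow> complex) \<Rightarrow> complex) \<Rightarrow> (nat \<Rightarrow> complex) set" where
  "Dom p m f = {z. (\<forall>i<m. z i \<noteq> 0) \<and> Rpoly p m z \<noteq> 0 \<and> f z \<noteq> 0}"

text \<open>The ring A_f = C[z^{\<plusminus>1}, 1/R, 1/f], realised as the ring of regular functions on Dom p m f
  (elements are compared by their values on Dom p m f).\<close>
definition LocRing :: "nat \<Rightarrow> nat \<Rightarrow> ((nat \<Rightarrow> complex) \<Rightarrow> complex) \<Rightarrow> ((nat \<Rightarrow> complex) \<Rightarrow> complex) set" where
  "LocRing p m f = {a. \<exists>P k. poly_fun m P \<and>
      (\<forall>z \<in> Dom p m f. a z = P z / ((\<Prod>i<m. z i) ^ k * Rpoly p m z ^ k * f z ^ k))}"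

abbreviation RingA :: "nat \<Rightarrow> nat \<Rightarrow> ((nat \<Rightarrow> complex) \<Rightarrow> complex) set" where
  "RingA p m \<equiv> LocRing p m (\<lambda>_. 1)"

text \<open>The polynomial ring A_f[xi_1..xi_m] (as functions of (z, xi), compared on Dom p m f \<times> C^m).\<close>
definition PolyOver :: "nat \<Rightarrow> nat \<Rightarrow> ((nat \<Rightarrow> complex) \<Rightarrow> complex)
      \<Rightarrow> ((nat \<Rightarrow> complex) \<Rightarrow> (nat \<Rightarrow> complex) \<Rightarrow> complex) set" where
  "PolyOver p m f = {G. \<exists>S c. finite S \<and> (\<forall>\<beta>\<in>S. c \<beta> \<in> LocRing p m f) \<and>
      (\<forall>z\<in>Dom p m f. \<forall>\<xi>. G z \<xi> = (\<Sum>\<beta>\<in>S. c \<beta> z * (\<Prod>i<m. \<xi> i ^ \<beta> i)))}"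

definition Ltilde :: "nat \<Rightarrow> nat \<Rightarrow> nat \<Rightarrow> (nat \<Rightarrow> complex) \<Rightarrow> (nat \<Rightarrow> complex) \<Rightarrow> complex" where
  "Ltilde p m k z \<xi> = (z k * \<xi> k) ^ p - z k ^ p * (\<Sum>j<m. z j * \<xi> j) ^ p"

definition IdealL :: "nat \<Rightarrow> nat \<Rightarrow> ((nat \<Rightarrow> complex) \<Rightarrow> complex)
      \<Rightarrow> ((nat \<Rightarrow> complex) \<Rightarrow> (nat \<Rightarrow> complex) \<Rightarrow> complex) set" where
  "IdealL p m f = {G. \<exists>H. (\<forall>k<m. H k \<in> PolyOver p m f) \<and>
      (\<forall>z\<in>Dom p m f. \<forall>\<xi>. G z \<xi> = (\<Sum>k<m. H k z \<xi> * Ltilde p m k z \<xi>))}"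

definition free_quotient_rank :: "nat \<Rightarrow> nat \<Rightarrow> ((nat \<Rightarrow> complex) \<Rightarrow> complex) \<Rightarrow> nat \<Rightarrow> bool" where
  "free_quotient_rank p m f r \<longleftrightarrow> (\<exists>b. (\<forall>j<r. b j \<in> PolyOver p m f) \<and>
     (\<forall>G\<in>PolyOver p m f. \<exists>c. (\<forall>j<r. c j \<in> LocRing p m f) \<and>
         (\<lambda>z \<xi>. G z \<xi> - (\<Sum>j<r. c j z * b j z \<xi>)) \<in> IdealL p m f) \<and>
     (\<forall>c. (\<forall>j<r. c j \<in> LocRing p m f) \<and> (\<lambda>z \<xi>. \<Sum>j<r. c j z * b j z \<xi>) \<in> IdealL p m f
         \<longrightarrow> (\<forall>j<r. \<forall>z\<in>Dom p m f. c j z = 0)))"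

text \<open>A[xi]/(L~) is a locally free A-module of rank r: there are f_1..f_n in A generating
  the unit ideal such that each localization (A[xi]/(L~))_{f_i} = A_{f_i}[xi]/(L~) is free of rank r.\<close>
definition locally_free_rank :: "nat \<Rightarrow> nat \<Rightarrow> nat \<Rightarrow> bool" where
  "locally_free_rank p m r \<longleftrightarrow> (\<exists>(n::nat) f a. (\<forall>i<n. f i \<in> RingA p m \<and> a i \<in> RingA p m) \<and>
     (\<forall>z\<in>Dom p m (\<lambda>_. 1). (\<Sum>i<n. a i z * f i z) = 1) \<and>
     (\<forall>i<n. free_quotient_rank p m (f i) r))"

end

theory Submission
  imports Defs "Jordan_Normal_Form.Determinant"
begin

text \<open>
  Put \<open>s = z\<^sub>1\<xi>\<^sub>1 + \<dots> + z\<^sub>m\<xi>\<^sub>m\<close>. As the \<open>z\<^sub>k\<close> are invertible, the ideal is generated by the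
  \<open>\<xi>\<^sub>k\<^sup>p - s\<^sup>p\<close>, so the quotient is the cokernel of \<open>s - Z\<close>, where \<open>Z\<close> is multiplication by
  \<open>z\<^sub>1\<xi>\<^sub>1 + \<dots> + z\<^sub>m\<xi>\<^sub>m\<close> on the free \<open>A[s]\<close>-module \<open>A[s,\<xi>]/(\<xi>\<^sub>k\<^sup>p - s\<^sup>p)\<close>. Setting \<open>s = 1\<close> turns the degree
  \<open>d\<close> part of this module into the module \<open>F\<^sub>d\<close> of functions of degree at most \<open>d\<close> on the \<open>m\<close>-tuples
  of \<open>p\<close>-th roots of unity, so the degree \<open>d\<close> part of the quotient is \<open>F\<^sub>d / (1 - Z)F\<^sub>d\<^sub>-\<^sub>1\<close>. Here
  \<open>1 - Z\<close> is diagonal with determinant \<open>R(z)\<close>, hence invertible; in particular the quotient vanishes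
  in degrees above \<open>m(p - 1)\<close>. The remaining relations form a polynomial matrix \<open>\<phi>\<close> with \<open>p\<^sup>m\<close> more rows
  than columns and a left inverse \<open>\<psi>\<close> over \<open>A\<close>. Expanding \<open>det(\<psi>\<phi>) = 1\<close> shows that the maximal
  minors of \<open>\<phi>\<close> generate the unit ideal, and where a maximal minor is inverted the basis elements of
  the remaining \<open>p\<^sup>m\<close> rows form a basis of the cokernel.
\<close>

section \<open>Polynomial functions and the localized rings\<close>

text \<open>Collecting the coefficients of equal exponents allows any finite index set, with
  repetitions. Disjoint sums and Cartesian products of index sets then give closure under addition
  and multiplication.\<close>

lemma poly_funI:
  assumes "finite K" and g: "\<And>z. g z = (\<Sum>k\<in>K. c k * (\<Prod>i<m. z i ^ \<alpha> k i))"
  shows "poly_fun m g"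
proof -
  have "g z = (\<Sum>\<beta>\<in>\<alpha> ` K. (\<Sum>k\<in>{k \<in> K. \<alpha> k = \<beta>}. c k) * (\<Prod>i<m. z i ^ \<beta> i))" for z
    unfolding g sum.image_gen[OF \<open>finite K\<close>, of _ \<alpha>]
    by (intro sum.cong refl) (auto simp: sum_distrib_right intro!: sum.cong)
  with \<open>finite K\<close> show ?thesis
    unfolding poly_fun_def
    by (intro exI[of _ "\<alpha> ` K"] exI[of _ "\<lambda>\<beta>. \<Sum>k\<in>{k \<in> K. \<alpha> k = \<beta>}. c k"]) auto
qed

lemma poly_fun_const: "poly_fun m (\<lambda>_. a)"
  by (rule poly_funI[of "{()}" _ "\<lambda>_. a" "\<lambda>_ _. 0"]) auto

lemma poly_fun_coord:
  assumes "i < m"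
  shows "poly_fun m (\<lambda>z. z i)"
proof (rule poly_funI[of "{()}" _ "\<lambda>_. 1" "\<lambda>_ j. if j = i then 1 else 0"])
  fix z :: "nat \<Rightarrow> complex"
  have "(\<Prod>j<m. z j ^ (if j = i then 1 else 0)) = (\<Prod>j<m. if j = i then z j else 1)"
    by (intro prod.cong) auto
  then show "z i = (\<Sum>k\<in>{()}. 1 * (\<Prod>j<m. z j ^ (if j = i then 1 else 0)))"
    using assms by simp
qed simp

lemma poly_fun_add:
  assumes "poly_fun m g" "poly_fun m h"
  shows "poly_fun m (\<lambda>z. g z + h z)"
proof -
  obtain S c where S: "finite S" "\<And>z. g z = (\<Sum>\<alpha>\<in>S. c \<alpha> * (\<Prod>i<m. z i ^ \<alpha> i))"
    using assms(1) unfolding poly_fun_def by blast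
  obtain T d where T: "finite T" "\<And>z. h z = (\<Sum>\<alpha>\<in>T. d \<alpha> * (\<Prod>i<m. z i ^ \<alpha> i))"
    using assms(2) unfolding poly_fun_def by blast
  show ?thesis
    by (rule poly_funI[of "S <+> T" _ "case_sum c d" "case_sum id id"])
      (use S T in \<open>auto simp: sum.Plus\<close>)
qed

lemma poly_fun_mult:
  assumes "poly_fun m g" "poly_fun m h"
  shows "poly_fun m (\<lambda>z. g z * h z)"
proof -
  obtain S c where S: "finite S" "\<And>z. g z = (\<Sum>\<alpha>\<in>S. c \<alpha> * (\<Prod>i<m. z i ^ \<alpha> i))"
    using assms(1) unfolding poly_fun_def by blast
  obtain T d where T: "finite T" "\<And>z. h z = (\<Sum>\<alpha>\<in>T. d \<alpha> * (\<Prod>i<m. z i ^ \<alpha> i))"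
    using assms(2) unfolding poly_fun_def by blast
  show ?thesis
  proof (rule poly_funI[of "S \<times> T" _ "\<lambda>(\<alpha>,\<beta>). c \<alpha> * d \<beta>" "\<lambda>(\<alpha>,\<beta>) i. \<alpha> i + \<beta> i"])
    fix z
    show "g z * h z = (\<Sum>k\<in>S \<times> T. (case k of (\<alpha>, \<beta>) \<Rightarrow> c \<alpha> * d \<beta>)
      * (\<Prod>i<m. z i ^ (case k of (\<alpha>, \<beta>) \<Rightarrow> \<lambda>i. \<alpha> i + \<beta> i) i))"
      unfolding S(2) T(2) sum_product sum.cartesian_product
      by (intro sum.cong refl) (auto simp: power_add prod.distrib algebra_simps)
  qed (use S T in auto)
qed

lemma poly_fun_sum: "(\<And>k. k \<in> K \<Longrightarrow> poly_fun m (g k)) \<Longrightarrow> poly_fun m (\<lambda>z. \<Sum>k\<in>K. g k z)"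
  by (induction K rule: infinite_finite_induct) (auto intro: poly_fun_const poly_fun_add)

lemma poly_fun_prod: "(\<And>k. k \<in> K \<Longrightarrow> poly_fun m (g k)) \<Longrightarrow> poly_fun m (\<lambda>z. \<Prod>k\<in>K. g k z)"
  by (induction K rule: infinite_finite_induct) (auto intro: poly_fun_const poly_fun_mult)

lemma poly_fun_power: "poly_fun m g \<Longrightarrow> poly_fun m (\<lambda>z. g z ^ n)"
  by (induction n) (auto intro: poly_fun_const poly_fun_mult)

lemma poly_fun_diff: "poly_fun m g \<Longrightarrow> poly_fun m h \<Longrightarrow> poly_fun m (\<lambda>z. g z - h z)"
  using poly_fun_add[OF _ poly_fun_mult[OF poly_fun_const[of m "-1"]], of g h] by simp

section \<open>The affine linear factors of R\<close>

definition omega :: "nat \<Rightarrow> (nat \<Rightarrow> nat) \<Rightarrow> nat \<Rightarrow> complex" where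
  "omega p t j = zeta p ^ t j"

definition roots :: "nat \<Rightarrow> nat \<Rightarrow> (nat \<Rightarrow> nat) set" where
  "roots p m = PiE {..<m} (\<lambda>_. {1..p})"

definition lin :: "nat \<Rightarrow> (nat \<Rightarrow> complex) \<Rightarrow> (nat \<Rightarrow> complex) \<Rightarrow> complex" where
  "lin m z \<xi> = (\<Sum>j<m. z j * \<xi> j)"

lemma finite_roots: "finite (roots p m)"
  unfolding roots_def by (intro finite_PiE) auto

lemma Rpoly_eq: "Rpoly p m z = (\<Prod>t\<in>roots p m. 1 - lin m z (omega p t))"
  unfolding Rpoly_def roots_def lin_def omega_def by (simp add: mult.commute)

lemma poly_fun_lin: "poly_fun m (\<lambda>z. lin m z \<xi>)"
  unfolding lin_def by (intro poly_fun_sum poly_fun_mult poly_fun_coord poly_fun_const) auto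

lemma poly_fun_Rpoly: "poly_fun m (Rpoly p m)"
  unfolding Rpoly_eq[abs_def]
  by (intro poly_fun_prod poly_fun_diff poly_fun_const poly_fun_lin)

text \<open>Only for polynomial \<open>f\<close> is \<^const>\<open>LocRing\<close> closed under the ring operations: its
  elements carry the same exponent on \<open>f\<close> and on the other inverted elements, so a denominator
  of \<open>f\<close> would interfere with them.\<close>

locale localization =
  fixes p m :: nat and f :: "(nat \<Rightarrow> complex) \<Rightarrow> complex"
  assumes p_pos: "p > 0" and poly_f: "poly_fun m f"
begin

text \<open>Inverting the coordinates, R and \<open>f\<close> amounts to inverting this one
  polynomial, so every fraction has a power of it as denominator.\<close>

definition den :: "(nat \<Rightarrow> complex) \<Rightarrow> complex" where
  "den z = (\<Prod>i<m. z i) * Rpoly p m z * f z"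

lemma poly_den: "poly_fun m den"
  unfolding den_def[abs_def]
  by (intro poly_fun_mult poly_fun_prod poly_fun_coord poly_fun_Rpoly poly_f) auto

lemma den_nonzero: "z \<in> Dom p m f \<Longrightarrow> den z \<noteq> 0"
  by (auto simp: Dom_def den_def)

lemma LocRing_iff:
  "a \<in> LocRing p m f \<longleftrightarrow> (\<exists>P k. poly_fun m P \<and> (\<forall>z\<in>Dom p m f. a z = P z / den z ^ k))"
  unfolding LocRing_def den_def by (simp add: power_mult_distrib)

lemma LocRingI: "poly_fun m P \<Longrightarrow> (\<And>z. z \<in> Dom p m f \<Longrightarrow> a z = P z / den z ^ k) \<Longrightarrow> a \<in> LocRing p m f"
  unfolding LocRing_iff by blast

lemma LocRing_cong:
  "a \<in> LocRing p m f \<Longrightarrow> (\<And>z. z \<in> Dom p m f \<Longrightarrow> b z = a z) \<Longrightarrow> b \<in> LocRing p m f"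
  unfolding LocRing_iff by auto

lemma LocRing_poly: "poly_fun m P \<Longrightarrow> P \<in> LocRing p m f"
  by (rule LocRingI[of P _ 0]) auto

lemma LocRing_const: "(\<lambda>_. a) \<in> LocRing p m f"
  by (intro LocRing_poly poly_fun_const)

lemma LocRing_add:
  assumes "a \<in> LocRing p m f" "b \<in> LocRing p m f"
  shows "(\<lambda>z. a z + b z) \<in> LocRing p m f"
proof -
  obtain P k where P: "poly_fun m P" "\<And>z. z \<in> Dom p m f \<Longrightarrow> a z = P z / den z ^ k"
    using assms(1) unfolding LocRing_iff by blast
  obtain Q l where Q: "poly_fun m Q" "\<And>z. z \<in> Dom p m f \<Longrightarrow> b z = Q z / den z ^ l"
    using assms(2) unfolding LocRing_iff by blast
  show ?thesis
  proof (rule LocRingI[of "\<lambda>z. P z * den z ^ l + Q z * den z ^ k" _ "k + l"])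
    show "poly_fun m (\<lambda>z. P z * den z ^ l + Q z * den z ^ k)"
      by (intro poly_fun_add poly_fun_mult poly_fun_power poly_den P Q)
    fix z assume z: "z \<in> Dom p m f"
    show "a z + b z = (P z * den z ^ l + Q z * den z ^ k) / den z ^ (k + l)"
      using den_nonzero[OF z] by (simp add: P(2)[OF z] Q(2)[OF z] field_simps power_add)
  qed
qed

lemma LocRing_mult:
  assumes "a \<in> LocRing p m f" "b \<in> LocRing p m f"
  shows "(\<lambda>z. a z * b z) \<in> LocRing p m f"
proof -
  obtain P k where P: "poly_fun m P" "\<And>z. z \<in> Dom p m f \<Longrightarrow> a z = P z / den z ^ k"
    using assms(1) unfolding LocRing_iff by blast
  obtain Q l where Q: "poly_fun m Q" "\<And>z. z \<in> Dom p m f \<Longrightarrow> b z = Q z / den z ^ l"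
    using assms(2) unfolding LocRing_iff by blast
  show ?thesis
    by (rule LocRingI[of "\<lambda>z. P z * Q z" _ "k + l"])
      (use P Q in \<open>auto intro: poly_fun_mult simp: power_add\<close>)
qed

lemma LocRing_diff:
  "a \<in> LocRing p m f \<Longrightarrow> b \<in> LocRing p m f \<Longrightarrow> (\<lambda>z. a z - b z) \<in> LocRing p m f"
  using LocRing_add[OF _ LocRing_mult[OF LocRing_const[of "-1"]], of a b] by simp

lemma LocRing_sum:
  "(\<And>k. k \<in> K \<Longrightarrow> a k \<in> LocRing p m f) \<Longrightarrow> (\<lambda>z. \<Sum>k\<in>K. a k z) \<in> LocRing p m f"
  by (induction K rule: infinite_finite_induct) (auto intro: LocRing_const LocRing_add)

lemma LocRing_prod:
  "(\<And>k. k \<in> K \<Longrightarrow> a k \<in> LocRing p m f) \<Longrightarrow> (\<lambda>z. \<Prod>k\<in>K. a k z) \<in> LocRing p m f"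
  by (induction K rule: infinite_finite_induct) (auto intro: LocRing_const LocRing_mult)

text \<open>A polynomial divisor of \<open>den\<close> is a unit: the cofactor \<open>h\<close> is
  the numerator of its inverse.\<close>

lemma LocRing_inverse:
  assumes "poly_fun m g" "poly_fun m h" and gh: "\<And>z. z \<in> Dom p m f \<Longrightarrow> g z * h z = den z"
  shows "(\<lambda>z. 1 / g z) \<in> LocRing p m f"
proof (rule LocRingI[of h _ 1])
  fix z assume z: "z \<in> Dom p m f"
  then show "1 / g z = h z / den z ^ 1"
    using gh[OF z, symmetric] den_nonzero[OF z] by auto
qed fact

lemma LocRing_inverse_f: "(\<lambda>z. 1 / f z) \<in> LocRing p m f"
  by (rule LocRing_inverse[of _ "\<lambda>z. (\<Prod>i<m. z i) * Rpoly p m z"])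
    (auto simp: den_def intro!: poly_f poly_fun_mult poly_fun_prod poly_fun_coord poly_fun_Rpoly)

lemma LocRing_inverse_coord:
  assumes "k < m"
  shows "(\<lambda>z. 1 / z k) \<in> LocRing p m f"
proof (rule LocRing_inverse[of _ "\<lambda>z. (\<Prod>i\<in>{..<m}-{k}. z i) * Rpoly p m z * f z"])
  show "z k * ((\<Prod>i\<in>{..<m} - {k}. z i) * Rpoly p m z * f z) = den z" for z
    using prod.remove[of "{..<m}" k z] assms by (simp add: den_def)
qed (use assms in \<open>auto intro!: poly_f poly_fun_mult poly_fun_prod poly_fun_coord poly_fun_Rpoly\<close>)

lemma LocRing_inverse_lin:
  assumes "t \<in> roots p m"
  shows "(\<lambda>z. 1 / (1 - lin m z (omega p t))) \<in> LocRing p m f"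
proof (rule LocRing_inverse[of _ "\<lambda>z. (\<Prod>t\<in>roots p m - {t}. 1 - lin m z (omega p t)) * ((\<Prod>i<m. z i) * f z)"])
  show "(1 - lin m z (omega p t)) * ((\<Prod>t\<in>roots p m - {t}. 1 - lin m z (omega p t)) * ((\<Prod>i<m. z i) * f z)) = den z" for z
    using prod.remove[OF finite_roots assms, of "\<lambda>t. 1 - lin m z (omega p t)"]
    by (simp add: den_def Rpoly_eq)
qed (auto intro!: poly_f poly_fun_mult poly_fun_prod poly_fun_coord poly_fun_diff poly_fun_const poly_fun_lin)

lemma LocRing_det:
  assumes "\<And>i j. i < n \<Longrightarrow> j < n \<Longrightarrow> F i j \<in> LocRing p m f"
  shows "(\<lambda>z. det (mat n n (\<lambda>(i,j). F i j z))) \<in> LocRing p m f"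
proof -
  have "(\<lambda>z. \<Sum>\<pi>\<in>{\<pi>. \<pi> permutes {0..<n}}. signof \<pi> * (\<Prod>i=0..<n. F i (\<pi> i) z)) \<in> LocRing p m f"
    by (intro LocRing_sum LocRing_mult LocRing_const LocRing_prod assms)
      (auto simp: permutes_in_image[where S = "{0..<n}", simplified])
  then show ?thesis
    by (rule LocRing_cong)
      (auto simp: det_def permutes_in_image[where S = "{0..<n}", simplified]
        intro!: sum.cong prod.cong)
qed

lemma LocRing_adj_mat:
  assumes F: "\<And>i j. i < n \<Longrightarrow> j < n \<Longrightarrow> F i j \<in> LocRing p m f" and "i < n" "j < n"
  shows "(\<lambda>z. adj_mat (mat n n (\<lambda>(i,j). F i j z)) $$ (i, j)) \<in> LocRing p m f"
proof -
  \<comment> \<open>\<open>?s i\<close> enumerates the indices other than \<open>i\<close>, which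
    brings the deleted matrix into the form required by \<open>LocRing_det\<close>.\<close>
  let ?s = "\<lambda>i k. if k < i then k else Suc k"
  have "(\<lambda>z. (-1) ^ (j + i) * det (mat (n-1) (n-1) (\<lambda>(k,l). F (?s j k) (?s i l) z))) \<in> LocRing p m f"
    using assms by (intro LocRing_mult LocRing_const LocRing_det F) auto
  moreover have "mat_delete (mat n n (\<lambda>(i,j). F i j z)) j i
      = mat (n-1) (n-1) (\<lambda>(k,l). F (?s j k) (?s i l) z)" for z
    using assms(2,3) by (auto simp: mat_delete_def intro!: eq_matI)
  ultimately show ?thesis
    using assms(2,3) by (simp add: adj_mat_def cofactor_def)
qed

section \<open>Polynomials in \<open>\<xi>\<close> and the ideal\<close>

lemma PolyOverI:
  assumes "finite K" and c: "\<And>k. k \<in> K \<Longrightarrow> c k \<in> LocRing p m f"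
    and G: "\<And>z \<xi>. z \<in> Dom p m f \<Longrightarrow> G z \<xi> = (\<Sum>k\<in>K. c k z * (\<Prod>i<m. \<xi> i ^ \<alpha> k i))"
  shows "G \<in> PolyOver p m f"
proof -
  define d where "d \<beta> z = (\<Sum>k\<in>{k \<in> K. \<alpha> k = \<beta>}. c k z)" for \<beta> z
  have "G z \<xi> = (\<Sum>\<beta>\<in>\<alpha> ` K. d \<beta> z * (\<Prod>i<m. \<xi> i ^ \<beta> i))" if "z \<in> Dom p m f" for z \<xi>
    unfolding G[OF that] sum.image_gen[OF \<open>finite K\<close>, of _ \<alpha>] d_def
    by (intro sum.cong refl) (auto simp: sum_distrib_right intro!: sum.cong)
  moreover have "d \<beta> \<in> LocRing p m f" for \<beta>
    unfolding d_def[abs_def] by (intro LocRing_sum c) auto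
  ultimately show ?thesis
    unfolding PolyOver_def using \<open>finite K\<close>
    by (intro CollectI exI[of _ "\<alpha> ` K"] exI[of _ d]) auto
qed

lemma PolyOverE:
  assumes "G \<in> PolyOver p m f"
  obtains S c where "finite S" "\<And>\<beta>. \<beta> \<in> S \<Longrightarrow> c \<beta> \<in> LocRing p m f"
    "\<And>z \<xi>. z \<in> Dom p m f \<Longrightarrow> G z \<xi> = (\<Sum>\<beta>\<in>S. c \<beta> z * (\<Prod>i<m. \<xi> i ^ \<beta> i))"
  using assms unfolding PolyOver_def by blast

lemma PolyOver_coeff: "a \<in> LocRing p m f \<Longrightarrow> (\<lambda>z _. a z) \<in> PolyOver p m f"
  by (rule PolyOverI[of "{()}" "\<lambda>_. a" _ "\<lambda>_ _. 0"]) auto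

lemma PolyOver_xi:
  assumes "i < m"
  shows "(\<lambda>_ \<xi>. \<xi> i) \<in> PolyOver p m f"
proof (rule PolyOverI[of "{()}" "\<lambda>_ _. 1" _ "\<lambda>_ j. if j = i then 1 else 0"])
  fix z \<xi> :: "nat \<Rightarrow> complex"
  have "(\<Prod>j<m. \<xi> j ^ (if j = i then 1 else 0)) = (\<Prod>j<m. if j = i then \<xi> j else 1)"
    by (intro prod.cong) auto
  then show "\<xi> i = (\<Sum>k\<in>{()}. 1 * (\<Prod>j<m. \<xi> j ^ (if j = i then 1 else 0)))"
    using assms by simp
qed (auto intro: LocRing_const)

lemma PolyOver_add:
  assumes "G \<in> PolyOver p m f" "H \<in> PolyOver p m f"
  shows "(\<lambda>z \<xi>. G z \<xi> + H z \<xi>) \<in> PolyOver p m f"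
proof -
  obtain S c where S: "finite S" "\<And>\<beta>. \<beta> \<in> S \<Longrightarrow> c \<beta> \<in> LocRing p m f"
    "\<And>z \<xi>. z \<in> Dom p m f \<Longrightarrow> G z \<xi> = (\<Sum>\<beta>\<in>S. c \<beta> z * (\<Prod>i<m. \<xi> i ^ \<beta> i))"
    by (rule PolyOverE[OF assms(1)]) blast
  obtain T d where T: "finite T" "\<And>\<beta>. \<beta> \<in> T \<Longrightarrow> d \<beta> \<in> LocRing p m f"
    "\<And>z \<xi>. z \<in> Dom p m f \<Longrightarrow> H z \<xi> = (\<Sum>\<beta>\<in>T. d \<beta> z * (\<Prod>i<m. \<xi> i ^ \<beta> i))"
    by (rule PolyOverE[OF assms(2)]) blast
  show ?thesis
    by (rule PolyOverI[of "S <+> T" "case_sum c d" _ "case_sum id id"])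
      (use S T in \<open>auto simp: sum.Plus\<close>)
qed

lemma PolyOver_mult:
  assumes "G \<in> PolyOver p m f" "H \<in> PolyOver p m f"
  shows "(\<lambda>z \<xi>. G z \<xi> * H z \<xi>) \<in> PolyOver p m f"
proof -
  obtain S c where S: "finite S" "\<And>\<beta>. \<beta> \<in> S \<Longrightarrow> c \<beta> \<in> LocRing p m f"
    "\<And>z \<xi>. z \<in> Dom p m f \<Longrightarrow> G z \<xi> = (\<Sum>\<beta>\<in>S. c \<beta> z * (\<Prod>i<m. \<xi> i ^ \<beta> i))"
    by (rule PolyOverE[OF assms(1)]) blast
  obtain T d where T: "finite T" "\<And>\<beta>. \<beta> \<in> T \<Longrightarrow> d \<beta> \<in> LocRing p m f"
    "\<And>z \<xi>. z \<in> Dom p m f \<Longrightarrow> H z \<xi> = (\<Sum>\<beta>\<in>T. d \<beta> z * (\<Prod>i<m. \<xi> i ^ \<beta> i))"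
    by (rule PolyOverE[OF assms(2)]) blast
  show ?thesis
  proof (rule PolyOverI[of "S \<times> T" "\<lambda>k z. c (fst k) z * d (snd k) z" _ "\<lambda>k i. fst k i + snd k i"])
    fix z \<xi> assume z: "z \<in> Dom p m f"
    show "G z \<xi> * H z \<xi> = (\<Sum>k\<in>S \<times> T. c (fst k) z * d (snd k) z
      * (\<Prod>i<m. \<xi> i ^ (fst k i + snd k i)))"
      unfolding S(3)[OF z] T(3)[OF z] sum_product sum.cartesian_product
      by (intro sum.cong refl) (auto simp: power_add prod.distrib algebra_simps)
  qed (use S T in \<open>auto intro: LocRing_mult\<close>)
qed

lemma PolyOver_sum:
  "(\<And>k. k \<in> K \<Longrightarrow> G k \<in> PolyOver p m f) \<Longrightarrow> (\<lambda>z \<xi>. \<Sum>k\<in>K. G k z \<xi>) \<in> PolyOver p m f"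
  by (induction K rule: infinite_finite_induct)
    (auto intro: PolyOver_coeff LocRing_const PolyOver_add)

lemma PolyOver_prod:
  "(\<And>k. k \<in> K \<Longrightarrow> G k \<in> PolyOver p m f) \<Longrightarrow> (\<lambda>z \<xi>. \<Prod>k\<in>K. G k z \<xi>) \<in> PolyOver p m f"
  by (induction K rule: infinite_finite_induct)
    (auto intro: PolyOver_coeff LocRing_const PolyOver_mult)

lemma PolyOver_power: "G \<in> PolyOver p m f \<Longrightarrow> (\<lambda>z \<xi>. G z \<xi> ^ n) \<in> PolyOver p m f"
  by (induction n) (auto intro: PolyOver_coeff LocRing_const PolyOver_mult)

lemma PolyOver_lin: "lin m \<in> PolyOver p m f"
  unfolding lin_def[abs_def]
  by (intro PolyOver_sum PolyOver_mult PolyOver_coeff LocRing_poly poly_fun_coord PolyOver_xi) auto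

section \<open>The ideal generated by the \<open>Ltilde\<close>\<close>

lemma IdealL_cong:
  "G \<in> IdealL p m f \<Longrightarrow> (\<And>z \<xi>. z \<in> Dom p m f \<Longrightarrow> H z \<xi> = G z \<xi>) \<Longrightarrow> H \<in> IdealL p m f"
  unfolding IdealL_def by auto

lemma IdealL_zero: "(\<lambda>_ _. 0) \<in> IdealL p m f"
  unfolding IdealL_def
  by (intro CollectI exI[of _ "\<lambda>_ _ _. 0"]) (auto intro: PolyOver_coeff LocRing_const)

lemma IdealL_add:
  assumes "G \<in> IdealL p m f" "H \<in> IdealL p m f"
  shows "(\<lambda>z \<xi>. G z \<xi> + H z \<xi>) \<in> IdealL p m f"
proof -
  obtain g where "\<forall>k<m. g k \<in> PolyOver p m f"
    "\<forall>z\<in>Dom p m f. \<forall>\<xi>. G z \<xi> = (\<Sum>k<m. g k z \<xi> * Ltilde p m k z \<xi>)"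
    using assms(1) unfolding IdealL_def by blast
  moreover obtain h where "\<forall>k<m. h k \<in> PolyOver p m f"
    "\<forall>z\<in>Dom p m f. \<forall>\<xi>. H z \<xi> = (\<Sum>k<m. h k z \<xi> * Ltilde p m k z \<xi>)"
    using assms(2) unfolding IdealL_def by blast
  ultimately show ?thesis
    unfolding IdealL_def
    by (intro CollectI exI[of _ "\<lambda>k z \<xi>. g k z \<xi> + h k z \<xi>"])
      (auto intro: PolyOver_add simp: sum.distrib algebra_simps)
qed

lemma IdealL_mult:
  assumes "Q \<in> PolyOver p m f" "G \<in> IdealL p m f"
  shows "(\<lambda>z \<xi>. Q z \<xi> * G z \<xi>) \<in> IdealL p m f"
proof -
  obtain g where "\<forall>k<m. g k \<in> PolyOver p m f"
    "\<forall>z\<in>Dom p m f. \<forall>\<xi>. G z \<xi> = (\<Sum>k<m. g k z \<xi> * Ltilde p m k z \<xi>)"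
    using assms(2) unfolding IdealL_def by blast
  then show ?thesis
    using assms(1) unfolding IdealL_def
    by (intro CollectI exI[of _ "\<lambda>k z \<xi>. Q z \<xi> * g k z \<xi>"])
      (auto intro: PolyOver_mult simp: sum_distrib_left algebra_simps)
qed

lemma IdealL_coeff_mult:
  "a \<in> LocRing p m f \<Longrightarrow> G \<in> IdealL p m f \<Longrightarrow> (\<lambda>z \<xi>. a z * G z \<xi>) \<in> IdealL p m f"
  using IdealL_mult[OF PolyOver_coeff] .

lemma IdealL_sum:
  "(\<And>k. k \<in> K \<Longrightarrow> G k \<in> IdealL p m f) \<Longrightarrow> (\<lambda>z \<xi>. \<Sum>k\<in>K. G k z \<xi>) \<in> IdealL p m f"
  by (induction K rule: infinite_finite_induct) (auto intro: IdealL_zero IdealL_add)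

lemma IdealL_Ltilde:
  assumes "k < m"
  shows "Ltilde p m k \<in> IdealL p m f"
  unfolding IdealL_def
proof (intro CollectI exI[of _ "\<lambda>j _ _. if j = k then 1 else 0"] conjI allI impI ballI)
  show "(\<lambda>_ _. if j = k then 1 else 0) \<in> PolyOver p m f" for j
    by (intro PolyOver_coeff LocRing_const)
  fix z \<xi>
  have "(\<Sum>j<m. (if j = k then 1 else 0) * Ltilde p m j z \<xi>)
      = (\<Sum>j<m. if j = k then Ltilde p m j z \<xi> else 0)"
    by (intro sum.cong) auto
  then show "Ltilde p m k z \<xi> = (\<Sum>j<m. (if j = k then 1 else 0) * Ltilde p m j z \<xi>)"
    using assms by simp
qed

end

section \<open>Functions on tuples of roots of unity\<close>

definition box :: "nat \<Rightarrow> nat \<Rightarrow> (nat \<Rightarrow> nat) set" where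
  "box p m = PiE {..<m} (\<lambda>_. {..<p})"

text \<open>On tuples of p-th roots of unity a monomial depends only on its exponents modulo
  \<open>p\<close>; this picks the representative in \<open>box\<close>.\<close>

definition red :: "nat \<Rightarrow> nat \<Rightarrow> (nat \<Rightarrow> nat) \<Rightarrow> nat \<Rightarrow> nat" where
  "red p m \<alpha> = (\<lambda>i\<in>{..<m}. \<alpha> i mod p)"

definition deg :: "nat \<Rightarrow> (nat \<Rightarrow> nat) \<Rightarrow> nat" where
  "deg m \<alpha> = (\<Sum>i<m. \<alpha> i)"

definition xmon :: "nat \<Rightarrow> (nat \<Rightarrow> nat) \<Rightarrow> (nat \<Rightarrow> complex) \<Rightarrow> complex" where
  "xmon m \<alpha> \<xi> = (\<Prod>i<m. \<xi> i ^ \<alpha> i)"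

text \<open>The exponent of the monomial \<gamma> times the \<open>j\<close>-th coordinate, reduced
  into the box.\<close>

definition shift :: "nat \<Rightarrow> nat \<Rightarrow> nat \<Rightarrow> (nat \<Rightarrow> nat) \<Rightarrow> nat \<Rightarrow> nat" where
  "shift p m j \<gamma> = red p m (\<gamma>(j := Suc (\<gamma> j)))"

lemma finite_box: "finite (box p m)"
  unfolding box_def by (intro finite_PiE) auto

lemma card_box: "card (box p m) = p ^ m"
  unfolding box_def by (simp add: card_PiE)

lemma deg_box_le:
  assumes "\<beta> \<in> box p m"
  shows "deg m \<beta> \<le> m * (p - 1)"
proof -
  have "\<beta> i \<le> p - 1" if "i \<in> {..<m}" for i
    using PiE_mem[OF assms[unfolded box_def] that] by auto
  then have "sum \<beta> {..<m} \<le> of_nat (card {..<m}) * (p - 1)"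
    by (rule sum_bounded_above)
  then show ?thesis
    by (simp add: deg_def)
qed

lemma red_in_box: "p > 0 \<Longrightarrow> red p m \<alpha> \<in> box p m"
  by (auto simp: red_def box_def)

lemma shift_in_box: "p > 0 \<Longrightarrow> shift p m j \<gamma> \<in> box p m"
  unfolding shift_def by (rule red_in_box)

text \<open>Division with remainder in each coordinate. The multiple of \<open>p\<close> becomes the
  exponent of \<open>lin\<close> in \<open>xmon_cong_hmon\<close>.\<close>

lemma deg_red: "deg m \<alpha> = deg m (red p m \<alpha>) + p * (\<Sum>i<m. \<alpha> i div p)"
  unfolding deg_def red_def by (simp add: sum_distrib_left flip: sum.distrib)

lemma deg_red_le: "deg m (red p m \<alpha>) \<le> deg m \<alpha>"
  using deg_red[of m \<alpha> p] by simp

lemma deg_upd_Suc: "j < m \<Longrightarrow> deg m (\<gamma>(j := Suc (\<gamma> j))) = Suc (deg m \<gamma>)"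
  unfolding deg_def by (subst (1 2) sum.remove[of "{..<m}" j]) auto

lemma deg_shift_le: "j < m \<Longrightarrow> deg m (shift p m j \<gamma>) \<le> Suc (deg m \<gamma>)"
  using deg_red_le[of m p "\<gamma>(j := Suc (\<gamma> j))"] by (simp add: shift_def deg_upd_Suc)

lemma xmon_upd_Suc: "j < m \<Longrightarrow> xmon m (\<gamma>(j := Suc (\<gamma> j))) \<xi> = \<xi> j * xmon m \<gamma> \<xi>"
  unfolding xmon_def by (subst (1 2) prod.remove[of "{..<m}" j]) auto

section \<open>Roots of unity and their characters\<close>

lemma zeta_power: "zeta p ^ k = cis (2 * pi * real k / real p)"
  by (simp add: zeta_def cis_conv_exp flip: exp_of_nat_mult) (simp add: algebra_simps)

lemma zeta_power_p: "p > 0 \<Longrightarrow> zeta p ^ p = 1"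
  by (simp add: zeta_power)

lemma zeta_nonzero: "zeta p \<noteq> 0"
  by (simp add: zeta_def)

lemma zeta_power_inj:
  assumes "a < p" "b < p" "zeta p ^ a = zeta p ^ b"
  shows "a = b"
  using bij_betw_roots_unity[of p] assms
  by (auto simp: zeta_power bij_betw_def inj_on_def)

lemma omega_power_p: "p > 0 \<Longrightarrow> omega p t j ^ p = 1"
  by (metis omega_def power_mult power_one zeta_power_p mult.commute)

lemma xmon_red_omega:
  assumes "p > 0"
  shows "xmon m (red p m \<alpha>) (omega p t) = xmon m \<alpha> (omega p t)"
proof -
  have "x ^ (n mod p) = x ^ n" if "x ^ p = 1" for x :: complex and n
  proof -
    have "x ^ n = (x ^ p) ^ (n div p) * x ^ (n mod p)"
      by (simp flip: power_mult power_add)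
    with that show ?thesis by simp
  qed
  then show ?thesis
    unfolding xmon_def red_def by (intro prod.cong) (auto simp: omega_power_p[OF assms])
qed

lemma xmon_shift_omega:
  "p > 0 \<Longrightarrow> j < m \<Longrightarrow> xmon m (shift p m j \<gamma>) (omega p t) = omega p t j * xmon m \<gamma> (omega p t)"
  by (simp add: shift_def xmon_red_omega xmon_upd_Suc)

lemma sum_root_powers:
  fixes w :: complex
  assumes "w ^ p = 1"
  shows "(\<Sum>t\<in>{1..p}. w ^ t) = (if w = 1 then of_nat p else 0)"
proof (cases "w = 1")
  case False
  \<comment> \<open>The exponents run from 1 to \<open>p\<close>, as in R; extracting one factor
    \<open>w\<close> gives the usual geometric range.\<close>
  have "(\<Sum>t\<in>{1..p}. w ^ t) = w * (\<Sum>t<p. w ^ t)"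
    unfolding sum_distrib_left
    by (rule sum.reindex_bij_witness[of _ Suc "\<lambda>t. t - 1"]) (auto simp flip: power_Suc)
  also have "(\<Sum>t<p. w ^ t) = 0"
    using False assms by (simp add: geometric_sum)
  finally show ?thesis using False by simp
qed simp

text \<open>Orthogonality of the characters of (Z/p)^m: a quotient of two characters is a character,
  and its sum factors into one sum of powers per coordinate. Division acts as complex conjugation,
  all values having modulus one.\<close>

lemma roots_orthogonality:
  assumes "\<beta> \<in> box p m" "\<gamma> \<in> box p m"
  shows "(\<Sum>t\<in>roots p m. xmon m \<gamma> (omega p t) / xmon m \<beta> (omega p t)) = (if \<beta> = \<gamma> then of_nat p ^ m else 0)"
proof -
  define w where "w i = zeta p ^ \<gamma> i / zeta p ^ \<beta> i" for i
  have lt: "\<beta> i < p" "\<gamma> i < p" if "i < m" for i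
    using assms that by (auto simp: box_def PiE_iff)
  have "(zeta p ^ n) ^ p = 1" if "n < p" for n
  proof -
    have "(zeta p ^ n) ^ p = (zeta p ^ p) ^ n"
      by (simp add: mult.commute flip: power_mult)
    with that show ?thesis by (simp add: zeta_power_p)
  qed
  then have w_p: "w i ^ p = 1" if "i < m" for i
    using lt[OF that] by (simp add: w_def power_divide)
  have w_1: "w i = 1 \<longleftrightarrow> \<beta> i = \<gamma> i" if "i < m" for i
    using lt[OF that] zeta_power_inj[of "\<gamma> i" p "\<beta> i"] by (auto simp: w_def zeta_nonzero)
  have "(\<Sum>t\<in>roots p m. xmon m \<gamma> (omega p t) / xmon m \<beta> (omega p t)) = (\<Sum>t\<in>roots p m. \<Prod>i<m. w i ^ t i)"
    unfolding xmon_def omega_def w_def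
    by (intro sum.cong refl)
      (auto simp: power_divide mult.commute simp flip: prod_dividef power_mult)
  also have "\<dots> = (\<Prod>i<m. \<Sum>t\<in>{1..p}. w i ^ t)"
    unfolding roots_def by (rule prod_sum_PiE[symmetric]) auto
  also have "\<dots> = (\<Prod>i<m. if \<beta> i = \<gamma> i then of_nat p else 0)"
    by (intro prod.cong) (auto simp: sum_root_powers[OF w_p] w_1 simp del: One_nat_def)
  also have "\<dots> = (if \<beta> = \<gamma> then of_nat p ^ m else 0)"
  proof (cases "\<beta> = \<gamma>")
    case False
    then obtain i where "i < m" "\<beta> i \<noteq> \<gamma> i"
      using assms PiE_ext unfolding box_def by (metis lessThan_iff)
    then show ?thesis using False by (auto intro!: bexI[of _ i])
  qed simp
  finally show ?thesis .
qed

text \<open>Fourier inversion: dividing by the monomial \<beta> and summing over all tuples extracts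
  p^m times the coefficient at \<beta>.\<close>

lemma xmon_omega_independent:
  assumes "p > 0" and eq: "\<And>t. t \<in> roots p m \<Longrightarrow>
      (\<Sum>\<gamma>\<in>box p m. a \<gamma> * xmon m \<gamma> (omega p t)) = (\<Sum>\<gamma>\<in>box p m. b \<gamma> * xmon m \<gamma> (omega p t))"
    and \<beta>: "\<beta> \<in> box p m"
  shows "a \<beta> = b \<beta>"
proof -
  have coeff: "(\<Sum>t\<in>roots p m. (\<Sum>\<gamma>\<in>box p m. c \<gamma> * xmon m \<gamma> (omega p t)) / xmon m \<beta> (omega p t)) = c \<beta> * of_nat p ^ m" for c
  proof -
    have "(\<Sum>t\<in>roots p m. (\<Sum>\<gamma>\<in>box p m. c \<gamma> * xmon m \<gamma> (omega p t)) / xmon m \<beta> (omega p t))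
      = (\<Sum>\<gamma>\<in>box p m. c \<gamma> * (\<Sum>t\<in>roots p m. xmon m \<gamma> (omega p t) / xmon m \<beta> (omega p t)))"
      unfolding sum_divide_distrib sum_distrib_left by (subst sum.swap) simp
    also have "\<dots> = (\<Sum>\<gamma>\<in>box p m. if \<beta> = \<gamma> then c \<gamma> * of_nat p ^ m else 0)"
      by (intro sum.cong) (auto simp: roots_orthogonality \<beta>)
    finally show ?thesis
      using \<beta> by (simp add: finite_box)
  qed
  have "a \<beta> * of_nat p ^ m = b \<beta> * of_nat p ^ m"
    unfolding coeff[symmetric] by (intro sum.cong) (auto simp: eq)
  with \<open>p > 0\<close> show ?thesis by simp
qed

text \<open>The matrix of multiplication by \<open>1 - lin m z\<close> on functions on the set of \<open>m\<close>-tuples of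
  \<open>p\<close>-th roots of unity, in the basis of the monomials with exponents in the box.\<close>

definition mulmat :: "nat \<Rightarrow> nat \<Rightarrow> (nat \<Rightarrow> complex) \<Rightarrow> (nat \<Rightarrow> nat) \<Rightarrow> (nat \<Rightarrow> nat) \<Rightarrow> complex" where
  "mulmat p m z \<delta> \<gamma> = (if \<delta> = \<gamma> then 1 else 0) - (\<Sum>j<m. if \<delta> = shift p m j \<gamma> then z j else 0)"

text \<open>Evaluation at the tuples diagonalizes multiplication by \<open>1 - lin m z\<close>; this
  is the inverse diagonal matrix, carried back to monomials by the Fourier transform.\<close>

definition mulinv :: "nat \<Rightarrow> nat \<Rightarrow> (nat \<Rightarrow> complex) \<Rightarrow> (nat \<Rightarrow> nat) \<Rightarrow> (nat \<Rightarrow> nat) \<Rightarrow> complex" where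
  "mulinv p m z \<gamma> \<beta> = (\<Sum>t\<in>roots p m. xmon m \<beta> (omega p t) / xmon m \<gamma> (omega p t) / of_nat p ^ m
     * (1 / (1 - lin m z (omega p t))))"

text \<open>Multiplying by a linear form raises the degree by at most one, and reduction never
  raises it. Hence blocks truncated by degree lose no entries.\<close>

lemma mulmat_eq_0:
  assumes "deg m \<gamma> < d" "\<not> deg m \<delta> \<le> d"
  shows "mulmat p m z \<delta> \<gamma> = 0"
proof -
  have "\<delta> \<noteq> \<gamma>" using assms by auto
  moreover have "\<delta> \<noteq> shift p m j \<gamma>" if "j < m" for j
    using assms deg_shift_le[OF that, of p \<gamma>] by auto
  ultimately show ?thesis by (simp add: mulmat_def)
qed

lemma sum_mulmat:
  assumes "p > 0" "\<gamma> \<in> box p m"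
  shows "(\<Sum>\<delta>\<in>box p m. mulmat p m z \<delta> \<gamma> * h \<delta>) = h \<gamma> - (\<Sum>j<m. z j * h (shift p m j \<gamma>))"
proof -
  have "(\<Sum>\<delta>\<in>box p m. mulmat p m z \<delta> \<gamma> * h \<delta>) =
    (\<Sum>\<delta>\<in>box p m. if \<delta> = \<gamma> then h \<delta> else 0) - (\<Sum>\<delta>\<in>box p m. \<Sum>j<m. if \<delta> = shift p m j \<gamma> then z j * h \<delta> else 0)"
    unfolding mulmat_def sum_subtractf[symmetric] left_diff_distrib sum_distrib_right
    by (intro sum.cong arg_cong2[of _ _ _ _ minus]) auto
  also have "\<dots> = h \<gamma> - (\<Sum>j<m. z j * h (shift p m j \<gamma>))"
    using assms by (subst sum.swap) (simp add: finite_box shift_in_box)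
  finally show ?thesis .
qed

text \<open>Evaluation at \<open>t\<close> is a left eigenvector of \<open>mulmat\<close>, with a
  factor of R as eigenvalue.\<close>

lemma sum_mulmat_xmon:
  assumes "p > 0" "\<gamma> \<in> box p m"
  shows "(\<Sum>\<delta>\<in>box p m. mulmat p m z \<delta> \<gamma> * xmon m \<delta> (omega p t)) = (1 - lin m z (omega p t)) * xmon m \<gamma> (omega p t)"
  unfolding sum_mulmat[OF assms]
  by (simp add: xmon_shift_omega[OF assms(1)] lin_def left_diff_distrib sum_distrib_right mult.assoc)

lemma bij_betw_shift:
  assumes "p > 0" "j < m"
  shows "bij_betw (shift p m j) (box p m) (box p m)"
proof -
  have "inj_on (shift p m j) (box p m)"
  proof (rule inj_onI)
    fix \<gamma> \<delta> assume \<gamma>: "\<gamma> \<in> box p m" and \<delta>: "\<delta> \<in> box p m" and eq: "shift p m j \<gamma> = shift p m j \<delta>"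
    have "\<gamma> i = \<delta> i" if i: "i \<in> {..<m}" for i
    proof -
      have lt: "\<gamma> i < p" "\<delta> i < p"
        using \<gamma> \<delta> i by (auto simp: box_def PiE_iff)
      have "(if i = j then Suc (\<gamma> i) else \<gamma> i) mod p = (if i = j then Suc (\<delta> i) else \<delta> i) mod p"
        using fun_cong[OF eq, of i] i by (auto simp: shift_def red_def split: if_splits)
      with lt show ?thesis
        by (auto simp: mod_Suc split: if_splits)
    qed
    then show "\<gamma> = \<delta>" using \<gamma> \<delta> PiE_ext unfolding box_def by blast
  qed
  moreover have "shift p m j ` box p m \<subseteq> box p m"
    using assms by (auto intro: shift_in_box)
  ultimately show ?thesis
    by (simp add: bij_betw_def endo_inj_surj finite_box)
qed

text \<open>The reciprocal characters are right eigenvectors for the same eigenvalues; reindexing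
  along the bijection \<open>shift\<close> shows this.\<close>

lemma sum_mulmat_inverse_xmon:
  assumes "p > 0" "\<delta> \<in> box p m"
  shows "(\<Sum>\<gamma>\<in>box p m. mulmat p m z \<delta> \<gamma> * (1 / xmon m \<gamma> (omega p t))) = (1 - lin m z (omega p t)) / xmon m \<delta> (omega p t)"
proof -
  let ?v = "\<lambda>\<gamma>. 1 / xmon m \<gamma> (omega p t)"
  have "omega p t j \<noteq> 0" for j by (simp add: omega_def zeta_nonzero)
  then have v: "?v \<gamma> = omega p t j * ?v (shift p m j \<gamma>)" if "j < m" for j \<gamma>
    by (simp add: xmon_shift_omega[OF assms(1) that])
  have shifted: "(\<Sum>\<gamma>\<in>box p m. if \<delta> = shift p m j \<gamma> then z j * ?v \<gamma> else 0) = z j * omega p t j * ?v \<delta>"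
    if "j < m" for j
  proof -
    have "(\<Sum>\<gamma>\<in>box p m. if \<delta> = shift p m j \<gamma> then z j * ?v \<gamma> else 0)
      = (\<Sum>\<gamma>\<in>box p m. (\<lambda>\<beta>. if \<delta> = \<beta> then z j * (omega p t j * ?v \<beta>) else 0) (shift p m j \<gamma>))"
      (is "?lhs = ?rhs")
    proof -
      have "z j * ?v \<gamma> = z j * (omega p t j * ?v (shift p m j \<gamma>))" for \<gamma>
        by (subst v[OF that]) (rule refl)
      then show "?lhs = ?rhs" by (simp only:)
    qed
    also have "\<dots> = (\<Sum>\<beta>\<in>box p m. if \<delta> = \<beta> then z j * (omega p t j * ?v \<beta>) else 0)"
      by (rule sum.reindex_bij_betw[OF bij_betw_shift[OF assms(1) that]])
    finally show ?thesis using assms by (simp add: finite_box)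
  qed
  have "(\<Sum>\<gamma>\<in>box p m. mulmat p m z \<delta> \<gamma> * ?v \<gamma>) =
    (\<Sum>\<gamma>\<in>box p m. if \<delta> = \<gamma> then ?v \<gamma> else 0) - (\<Sum>\<gamma>\<in>box p m. \<Sum>j<m. if \<delta> = shift p m j \<gamma> then z j * ?v \<gamma> else 0)"
    unfolding mulmat_def sum_subtractf[symmetric] left_diff_distrib sum_distrib_right
    by (intro sum.cong arg_cong2[of _ _ _ _ minus]) auto
  also have "\<dots> = ?v \<delta> - (\<Sum>j<m. z j * omega p t j * ?v \<delta>)"
    using assms shifted by (subst sum.swap) (simp add: finite_box)
  finally show ?thesis
    by (simp add: lin_def diff_divide_distrib sum_divide_distrib)
qed

text \<open>By the left eigenvectors each eigenvalue cancels against its reciprocal, and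
  orthogonality evaluates the rest. This side makes \<open>relinv\<close> a left inverse.\<close>

lemma mulinv_mulmat:
  assumes "p > 0" "\<beta> \<in> box p m" "\<gamma> \<in> box p m" and z: "Rpoly p m z \<noteq> 0"
  shows "(\<Sum>\<delta>\<in>box p m. mulinv p m z \<beta> \<delta> * mulmat p m z \<delta> \<gamma>) = (if \<beta> = \<gamma> then 1 else 0)"
proof -
  have nz: "1 - lin m z (omega p t) \<noteq> 0" if "t \<in> roots p m" for t
    using z that finite_roots[of p m] by (auto simp: Rpoly_eq)
  have "(\<Sum>\<delta>\<in>box p m. mulinv p m z \<beta> \<delta> * mulmat p m z \<delta> \<gamma>)
    = (\<Sum>t\<in>roots p m. \<Sum>\<delta>\<in>box p m. (mulmat p m z \<delta> \<gamma> * xmon m \<delta> (omega p t))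
         * (1 / xmon m \<beta> (omega p t) / of_nat p ^ m / (1 - lin m z (omega p t))))"
    unfolding mulinv_def sum_distrib_right by (subst sum.swap) (simp add: mult_ac)
  also have "\<dots> = (\<Sum>t\<in>roots p m. xmon m \<gamma> (omega p t) / xmon m \<beta> (omega p t) / of_nat p ^ m)"
    unfolding sum_distrib_right[symmetric] sum_mulmat_xmon[OF assms(1,3)]
    by (intro sum.cong refl) (use nz in simp)
  also have "\<dots> = (\<Sum>t\<in>roots p m. xmon m \<gamma> (omega p t) / xmon m \<beta> (omega p t)) / of_nat p ^ m"
    by (rule sum_divide_distrib[symmetric])
  finally show ?thesis
    unfolding roots_orthogonality[OF assms(2,3)] using \<open>p > 0\<close> by simp
qed

text \<open>The same argument with the right eigenvectors. This side makes the quotient vanish in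
  high degrees.\<close>

lemma mulmat_mulinv:
  assumes "p > 0" "\<beta> \<in> box p m" "\<delta> \<in> box p m" and z: "Rpoly p m z \<noteq> 0"
  shows "(\<Sum>\<gamma>\<in>box p m. mulinv p m z \<gamma> \<beta> * mulmat p m z \<delta> \<gamma>) = (if \<delta> = \<beta> then 1 else 0)"
proof -
  have nz: "1 - lin m z (omega p t) \<noteq> 0" if "t \<in> roots p m" for t
    using z that finite_roots[of p m] by (auto simp: Rpoly_eq)
  have "(\<Sum>\<gamma>\<in>box p m. mulinv p m z \<gamma> \<beta> * mulmat p m z \<delta> \<gamma>)
    = (\<Sum>t\<in>roots p m. \<Sum>\<gamma>\<in>box p m. (mulmat p m z \<delta> \<gamma> * (1 / xmon m \<gamma> (omega p t)))
         * (xmon m \<beta> (omega p t) / of_nat p ^ m / (1 - lin m z (omega p t))))"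
    unfolding mulinv_def sum_distrib_right by (subst sum.swap) (simp add: mult_ac)
  also have "\<dots> = (\<Sum>t\<in>roots p m. xmon m \<beta> (omega p t) / xmon m \<delta> (omega p t) / of_nat p ^ m)"
    unfolding sum_distrib_right[symmetric] sum_mulmat_inverse_xmon[OF assms(1,3)]
    by (intro sum.cong refl) (use nz in simp)
  also have "\<dots> = (\<Sum>t\<in>roots p m. xmon m \<beta> (omega p t) / xmon m \<delta> (omega p t)) / of_nat p ^ m"
    by (rule sum_divide_distrib[symmetric])
  finally show ?thesis
    unfolding roots_orthogonality[OF assms(3,2)] using \<open>p > 0\<close> by simp
qed

lemma poly_fun_mulmat: "poly_fun m (\<lambda>z. mulmat p m z \<delta> \<gamma>)"
proof -
  have "poly_fun m (\<lambda>z. if b then z j else 0)" if "j < m" for b j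
    using that by (cases b) (auto intro: poly_fun_coord poly_fun_const)
  then show ?thesis
    unfolding mulmat_def by (intro poly_fun_diff poly_fun_const poly_fun_sum) auto
qed

section \<open>Presentation of the quotient\<close>

text \<open>Modulo the ideal, \<open>\<xi> k ^ p = lin m z \<xi> ^ p\<close> for all \<open>k\<close>. Hence in degree \<open>d\<close> the quotient is
  spanned by the following products.\<close>

definition hmon :: "nat \<Rightarrow> nat \<Rightarrow> (nat \<Rightarrow> nat) \<Rightarrow> (nat \<Rightarrow> complex) \<Rightarrow> (nat \<Rightarrow> complex) \<Rightarrow> complex" where
  "hmon m d \<beta> z \<xi> = lin m z \<xi> ^ (d - deg m \<beta>) * xmon m \<beta> \<xi>"

text \<open>Indices of the generators \<open>hmon m d \<beta>\<close>. The condition on \<beta>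
  makes the subtraction in \<open>hmon\<close> genuine; degrees above the bound contribute nothing,
  by \<open>hmon_in_ideal\<close>.\<close>

definition row_idx :: "nat \<Rightarrow> nat \<Rightarrow> (nat \<times> (nat \<Rightarrow> nat)) set" where
  "row_idx p m = Sigma {..m * (p - 1)} (\<lambda>d. {\<beta> \<in> box p m. deg m \<beta> \<le> d})"

text \<open>A relation in degree \<open>d\<close> comes from multiplying an element of degree
  \<open>d - 1\<close> by \<open>lin\<close> in two ways, hence the strict inequality.\<close>

definition col_idx :: "nat \<Rightarrow> nat \<Rightarrow> (nat \<times> (nat \<Rightarrow> nat)) set" where
  "col_idx p m = Sigma {..m * (p - 1)} (\<lambda>d. {\<beta> \<in> box p m. deg m \<beta> < d})"

lemma finite_row_idx: "finite (row_idx p m)"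
  unfolding row_idx_def using finite_box by auto

lemma finite_col_idx: "finite (col_idx p m)"
  unfolding col_idx_def using finite_box by auto

text \<open>The additional rows are the pairs whose exponent has degree exactly \<open>d\<close>,
  one for each element of the box. This difference is the rank.\<close>

lemma card_row_idx: "card (row_idx p m) = card (col_idx p m) + p ^ m"
proof -
  let ?diag = "(\<lambda>\<beta>. (deg m \<beta>, \<beta>)) ` box p m"
  have "row_idx p m = col_idx p m \<union> ?diag"
    by (auto simp: row_idx_def col_idx_def dest: deg_box_le)
  moreover have "col_idx p m \<inter> ?diag = {}"
    by (auto simp: col_idx_def)
  moreover have "card ?diag = p ^ m"
    by (subst card_image) (auto simp: card_box inj_on_def)
  ultimately show ?thesis
    by (simp add: card_Un_disjoint finite_col_idx finite_box)
qed

context localization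
begin

section \<open>Congruences modulo the ideal\<close>

definition ideal_cong (infix "\<approx>" 50) where
  "G \<approx> H \<longleftrightarrow> (\<lambda>z \<xi>. G z \<xi> - H z \<xi>) \<in> IdealL p m f"

lemma ideal_cong_refl: "G \<approx> G"
  unfolding ideal_cong_def using IdealL_zero by simp

text \<open>GH - G'H' = H(G - G') + G'(H - H'), where \<open>H\<close> and \<open>G'\<close> are the
  multipliers that have to be polynomials.\<close>

lemma ideal_cong_mult:
  assumes "G \<approx> G'" "H \<approx> H'" "H \<in> PolyOver p m f" "G' \<in> PolyOver p m f"
  shows "(\<lambda>z \<xi>. G z \<xi> * H z \<xi>) \<approx> (\<lambda>z \<xi>. G' z \<xi> * H' z \<xi>)"
  using IdealL_add[OF IdealL_mult[OF assms(3) assms(1)[unfolded ideal_cong_def]]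
      IdealL_mult[OF assms(4) assms(2)[unfolded ideal_cong_def]]]
  unfolding ideal_cong_def by (rule IdealL_cong) (simp add: algebra_simps)

lemma ideal_cong_prod:
  assumes "finite K" "\<And>k. k \<in> K \<Longrightarrow> G k \<approx> H k"
    "\<And>k. k \<in> K \<Longrightarrow> G k \<in> PolyOver p m f" "\<And>k. k \<in> K \<Longrightarrow> H k \<in> PolyOver p m f"
  shows "(\<lambda>z \<xi>. \<Prod>k\<in>K. G k z \<xi>) \<approx> (\<lambda>z \<xi>. \<Prod>k\<in>K. H k z \<xi>)"
  using assms
  by (induction K) (auto simp: ideal_cong_refl intro!: ideal_cong_mult PolyOver_prod)

lemma ideal_cong_power:
  assumes "G \<approx> H" "G \<in> PolyOver p m f" "H \<in> PolyOver p m f"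
  shows "(\<lambda>z \<xi>. G z \<xi> ^ n) \<approx> (\<lambda>z \<xi>. H z \<xi> ^ n)"
  using ideal_cong_prod[of "{..<n}" "\<lambda>_. G" "\<lambda>_. H"] assms by simp

text \<open>\<open>Ltilde p m k\<close> is divided by the unit \<open>z k ^ p\<close>.\<close>

lemma xi_power_cong:
  assumes "k < m"
  shows "(\<lambda>z \<xi>. \<xi> k ^ p) \<approx> (\<lambda>z \<xi>. lin m z \<xi> ^ p)"
proof -
  have "(\<lambda>z. \<Prod>_<p. 1 / z k) \<in> LocRing p m f"
    by (intro LocRing_prod LocRing_inverse_coord assms)
  then have "(\<lambda>z \<xi>. (\<Prod>_<p. 1 / z k) * Ltilde p m k z \<xi>) \<in> IdealL p m f"
    by (intro IdealL_coeff_mult IdealL_Ltilde assms)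
  then show ?thesis
    unfolding ideal_cong_def
    by (rule IdealL_cong)
      (use assms in \<open>auto simp: Dom_def Ltilde_def lin_def field_simps\<close>)
qed

lemma PolyOver_xmon: "(\<lambda>_. xmon m \<alpha>) \<in> PolyOver p m f"
  unfolding xmon_def[abs_def] by (intro PolyOver_prod PolyOver_power PolyOver_xi) auto

lemma PolyOver_hmon: "hmon m d \<beta> \<in> PolyOver p m f"
  unfolding hmon_def[abs_def] by (intro PolyOver_mult PolyOver_power PolyOver_lin PolyOver_xmon)

text \<open>Each exponent is divided by \<open>p\<close> with remainder and every
  \<open>\<xi> i ^ p\<close> is replaced by \<open>lin m z \<xi> ^ p\<close>; by
  \<open>deg_red\<close> the powers of \<open>lin\<close> add up correctly.\<close>

lemma xmon_cong_hmon: "(\<lambda>_. xmon m \<alpha>) \<approx> hmon m (deg m \<alpha>) (red p m \<alpha>)"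
proof -
  have "(\<lambda>z \<xi>. \<Prod>i<m. (\<xi> i ^ p) ^ (\<alpha> i div p) * \<xi> i ^ (\<alpha> i mod p))
     \<approx> (\<lambda>z \<xi>. \<Prod>i<m. (lin m z \<xi> ^ p) ^ (\<alpha> i div p) * \<xi> i ^ (\<alpha> i mod p))"
    by (intro ideal_cong_prod ideal_cong_mult ideal_cong_power ideal_cong_refl xi_power_cong
        PolyOver_mult PolyOver_power PolyOver_xi PolyOver_lin) auto
  moreover have "(\<Prod>i<m. (\<xi> i ^ p) ^ (\<alpha> i div p) * \<xi> i ^ (\<alpha> i mod p)) = xmon m \<alpha> \<xi>" for \<xi> :: "nat \<Rightarrow> complex"
    unfolding xmon_def by (simp flip: power_mult power_add)
  moreover have "(\<Prod>i<m. (lin m z \<xi> ^ p) ^ (\<alpha> i div p) * \<xi> i ^ (\<alpha> i mod p))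
      = hmon m (deg m \<alpha>) (red p m \<alpha>) z \<xi>" for z \<xi>
    using deg_red[of m \<alpha> p]
    by (simp add: hmon_def xmon_def red_def prod.distrib sum_distrib_left flip: power_mult power_sum)
  ultimately show ?thesis by simp
qed

text \<open>The product of \<open>lin\<close> with
  \<open>lin ^ (d - 1 - deg m \<gamma>) * xmon m \<gamma>\<close> is
  \<open>hmon m d \<gamma>\<close>; expanding that factor \<open>lin\<close> and reducing each
  \<open>\<xi> j * xmon m \<gamma>\<close> into the box gives a congruent expression. The difference
  is column \<gamma> of \<open>mulmat\<close>.\<close>

lemma column_in_ideal:
  assumes "\<gamma> \<in> box p m" "deg m \<gamma> < d"
  shows "(\<lambda>z \<xi>. \<Sum>\<delta>\<in>box p m. mulmat p m z \<delta> \<gamma> * hmon m d \<delta> z \<xi>) \<in> IdealL p m f"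
proof -
  have "(\<lambda>z \<xi>. \<Sum>j<m. z j * (lin m z \<xi> ^ (d - 1 - deg m \<gamma>)
     * (xmon m (\<gamma>(j := Suc (\<gamma> j))) \<xi> - hmon m (Suc (deg m \<gamma>)) (shift p m j \<gamma>) z \<xi>))) \<in> IdealL p m f"
  proof (intro IdealL_sum IdealL_coeff_mult IdealL_mult LocRing_poly poly_fun_coord PolyOver_power PolyOver_lin)
    fix j assume "j \<in> {..<m}"
    then show "(\<lambda>z \<xi>. xmon m (\<gamma>(j := Suc (\<gamma> j))) \<xi> - hmon m (Suc (deg m \<gamma>)) (shift p m j \<gamma>) z \<xi>) \<in> IdealL p m f"
      using xmon_cong_hmon[of "\<gamma>(j := Suc (\<gamma> j))"]
      by (simp add: deg_upd_Suc ideal_cong_def flip: shift_def)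
  qed auto
  then show ?thesis
  proof (rule IdealL_cong)
    fix z \<xi>
    have "z j * (lin m z \<xi> ^ (d - 1 - deg m \<gamma>)
     * (xmon m (\<gamma>(j := Suc (\<gamma> j))) \<xi> - hmon m (Suc (deg m \<gamma>)) (shift p m j \<gamma>) z \<xi>))
      = z j * \<xi> j * (lin m z \<xi> ^ (d - 1 - deg m \<gamma>) * xmon m \<gamma> \<xi>) - z j * hmon m d (shift p m j \<gamma>) z \<xi>"
      if "j < m" for j
    proof -
      \<comment> \<open>No subtraction is truncated, as a shift raises the degree by at most
        one.\<close>
      have "d - deg m (shift p m j \<gamma>) = (d - 1 - deg m \<gamma>) + (Suc (deg m \<gamma>) - deg m (shift p m j \<gamma>))"
        using deg_shift_le[OF that, of p \<gamma>] assms(2) by simp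
      then show ?thesis
        unfolding hmon_def xmon_upd_Suc[OF that] by (simp add: power_add algebra_simps)
    qed
    then have "(\<Sum>j<m. z j * (lin m z \<xi> ^ (d - 1 - deg m \<gamma>)
     * (xmon m (\<gamma>(j := Suc (\<gamma> j))) \<xi> - hmon m (Suc (deg m \<gamma>)) (shift p m j \<gamma>) z \<xi>)))
      = lin m z \<xi> * (lin m z \<xi> ^ (d - 1 - deg m \<gamma>) * xmon m \<gamma> \<xi>) - (\<Sum>j<m. z j * hmon m d (shift p m j \<gamma>) z \<xi>)"
      by (simp add: sum_subtractf lin_def sum_distrib_right)
    also have "lin m z \<xi> * (lin m z \<xi> ^ (d - 1 - deg m \<gamma>) * xmon m \<gamma> \<xi>) = hmon m d \<gamma> z \<xi>"
    proof -
      have "d - deg m \<gamma> = Suc (d - 1 - deg m \<gamma>)" using assms(2) by simp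
      then show ?thesis unfolding hmon_def by simp
    qed
    finally have "hmon m d \<gamma> z \<xi> - (\<Sum>j<m. z j * hmon m d (shift p m j \<gamma>) z \<xi>) = (\<Sum>j<m. z j * (lin m z \<xi> ^ (d - 1 - deg m \<gamma>)
     * (xmon m (\<gamma>(j := Suc (\<gamma> j))) \<xi> - hmon m (Suc (deg m \<gamma>)) (shift p m j \<gamma>) z \<xi>)))"
      by (rule sym)
    then show "(\<Sum>\<delta>\<in>box p m. mulmat p m z \<delta> \<gamma> * hmon m d \<delta> z \<xi>) =
      (\<Sum>j<m. z j * (lin m z \<xi> ^ (d - 1 - deg m \<gamma>)
     * (xmon m (\<gamma>(j := Suc (\<gamma> j))) \<xi> - hmon m (Suc (deg m \<gamma>)) (shift p m j \<gamma>) z \<xi>)))"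
      unfolding sum_mulmat[OF p_pos assms(1)] .
  qed
qed

lemma LocRing_mulinv: "(\<lambda>z. mulinv p m z \<gamma> \<beta>) \<in> LocRing p m f"
  unfolding mulinv_def by (intro LocRing_sum LocRing_mult LocRing_const LocRing_inverse_lin)

text \<open>In such a degree every box exponent has degree below \<open>d\<close>, so all columns of
  the square matrix \<open>mulmat\<close> are relations, and its inverse isolates each
  generator.\<close>

lemma hmon_in_ideal:
  assumes \<beta>: "\<beta> \<in> box p m" and d: "d > m * (p - 1)"
  shows "hmon m d \<beta> \<in> IdealL p m f"
proof -
  have "(\<lambda>z \<xi>. \<Sum>\<gamma>\<in>box p m. mulinv p m z \<gamma> \<beta> * (\<Sum>\<delta>\<in>box p m. mulmat p m z \<delta> \<gamma> * hmon m d \<delta> z \<xi>)) \<in> IdealL p m f"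
    using le_less_trans[OF deg_box_le d]
    by (intro IdealL_sum IdealL_coeff_mult LocRing_mulinv column_in_ideal)
  then show ?thesis
  proof (rule IdealL_cong)
    fix z \<xi> assume "z \<in> Dom p m f"
    then have R: "Rpoly p m z \<noteq> 0" by (simp add: Dom_def)
    have "(\<Sum>\<gamma>\<in>box p m. mulinv p m z \<gamma> \<beta> * (\<Sum>\<delta>\<in>box p m. mulmat p m z \<delta> \<gamma> * hmon m d \<delta> z \<xi>))
      = (\<Sum>\<delta>\<in>box p m. (\<Sum>\<gamma>\<in>box p m. mulinv p m z \<gamma> \<beta> * mulmat p m z \<delta> \<gamma>) * hmon m d \<delta> z \<xi>)"
      unfolding sum_distrib_left sum_distrib_right by (subst sum.swap) (simp add: mult.assoc)
    also have "\<dots> = (\<Sum>\<delta>\<in>box p m. if \<delta> = \<beta> then hmon m d \<delta> z \<xi> else 0)"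
      by (intro sum.cong refl) (simp add: mulmat_mulinv[OF p_pos \<beta> _ R])
    finally show "hmon m d \<beta> z \<xi> = (\<Sum>\<gamma>\<in>box p m. mulinv p m z \<gamma> \<beta> *
        (\<Sum>\<delta>\<in>box p m. mulmat p m z \<delta> \<gamma> * hmon m d \<delta> z \<xi>))"
      using \<beta> by (simp add: finite_box)
  qed
qed

lemma hmon_spanning:
  assumes "G \<in> PolyOver p m f"
  obtains c where "\<And>i. c i \<in> LocRing p m f"
    "G \<approx> (\<lambda>z \<xi>. \<Sum>i\<in>row_idx p m. c i z * hmon m (fst i) (snd i) z \<xi>)"
proof -
  obtain S a where S: "finite S" "\<And>\<alpha>. \<alpha> \<in> S \<Longrightarrow> a \<alpha> \<in> LocRing p m f"
    "\<And>z \<xi>. z \<in> Dom p m f \<Longrightarrow> G z \<xi> = (\<Sum>\<alpha>\<in>S. a \<alpha> z * (\<Prod>i<m. \<xi> i ^ \<alpha> i))"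
    by (rule PolyOverE[OF assms]) blast
  define idx where "idx \<alpha> = (deg m \<alpha>, red p m \<alpha>)" for \<alpha>
  \<comment> \<open>Several monomials may reduce to the same generator; their coefficients are
    added.\<close>
  define c where "c i z = (\<Sum>\<alpha>\<in>S. a \<alpha> z * (if i = idx \<alpha> then 1 else 0))" for i z
  have c: "c i \<in> LocRing p m f" for i
    unfolding c_def[abs_def] by (intro LocRing_sum LocRing_mult LocRing_const S)
  have red: "(\<lambda>z \<xi>. xmon m \<alpha> \<xi> - (if idx \<alpha> \<in> row_idx p m then hmon m (deg m \<alpha>) (red p m \<alpha>) z \<xi> else 0)) \<in> IdealL p m f" for \<alpha>
  proof (cases "idx \<alpha> \<in> row_idx p m")
    case True
    then show ?thesis using xmon_cong_hmon[of \<alpha>] by (simp add: ideal_cong_def)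
  next
    case False
    \<comment> \<open>The reduced exponent meets the other conditions of \<open>row_idx\<close>, so
      only the degree bound can fail.\<close>
    then have "deg m \<alpha> > m * (p - 1)"
      using deg_red_le[of m p \<alpha>] red_in_box[OF p_pos, of m \<alpha>] by (auto simp: row_idx_def idx_def)
    from hmon_in_ideal[OF red_in_box[OF p_pos] this]
    have "hmon m (deg m \<alpha>) (red p m \<alpha>) \<in> IdealL p m f" .
    from IdealL_add[OF xmon_cong_hmon[of \<alpha>, unfolded ideal_cong_def] this] False
    show ?thesis by simp
  qed
  have "(\<lambda>z \<xi>. \<Sum>\<alpha>\<in>S. a \<alpha> z * (xmon m \<alpha> \<xi> - (if idx \<alpha> \<in> row_idx p m then hmon m (deg m \<alpha>) (red p m \<alpha>) z \<xi> else 0))) \<in> IdealL p m f"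
    by (intro IdealL_sum IdealL_coeff_mult S red)
  then have "G \<approx> (\<lambda>z \<xi>. \<Sum>i\<in>row_idx p m. c i z * hmon m (fst i) (snd i) z \<xi>)"
    unfolding ideal_cong_def
  proof (rule IdealL_cong)
    fix z \<xi> assume z: "z \<in> Dom p m f"
    have "(\<Sum>i\<in>row_idx p m. c i z * hmon m (fst i) (snd i) z \<xi>)
      = (\<Sum>\<alpha>\<in>S. \<Sum>i\<in>row_idx p m. if i = idx \<alpha> then a \<alpha> z * hmon m (fst i) (snd i) z \<xi> else 0)"
      unfolding c_def sum_distrib_right by (subst sum.swap) (intro sum.cong refl, simp)
    also have "\<dots> = (\<Sum>\<alpha>\<in>S. a \<alpha> z * (if idx \<alpha> \<in> row_idx p m then hmon m (deg m \<alpha>) (red p m \<alpha>) z \<xi> else 0))"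
      by (intro sum.cong refl) (simp add: finite_row_idx idx_def)
    finally show "G z \<xi> - (\<Sum>i\<in>row_idx p m. c i z * hmon m (fst i) (snd i) z \<xi>)
      = (\<Sum>\<alpha>\<in>S. a \<alpha> z * (xmon m \<alpha> \<xi> - (if idx \<alpha> \<in> row_idx p m then hmon m (deg m \<alpha>) (red p m \<alpha>) z \<xi> else 0)))"
      unfolding S(3)[OF z] by (simp add: xmon_def right_diff_distrib sum_subtractf)
  qed
  with c that show ?thesis by blast
qed

end

section \<open>Independence in the fibres\<close>

text \<open>Restrictions of polynomials of degree less than \<open>d\<close> to the tuples of roots of unity.\<close>

definition lowspan :: "nat \<Rightarrow> nat \<Rightarrow> nat \<Rightarrow> ((nat \<Rightarrow> nat) \<Rightarrow> complex) set" where
  "lowspan p m d = {q. \<exists>x. \<forall>t\<in>roots p m.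
     q t = (\<Sum>\<gamma>\<in>{\<gamma> \<in> box p m. deg m \<gamma> < d}. x \<gamma> * xmon m \<gamma> (omega p t))}"

lemma lowspan_zero: "(\<lambda>_. 0) \<in> lowspan p m d"
  unfolding lowspan_def by (intro CollectI exI[of _ "\<lambda>_. 0"]) simp

lemma lowspan_add:
  assumes "q \<in> lowspan p m d" "r \<in> lowspan p m d"
  shows "(\<lambda>t. q t + r t) \<in> lowspan p m d"
proof -
  obtain x where "\<forall>t\<in>roots p m. q t = (\<Sum>\<gamma>\<in>{\<gamma> \<in> box p m. deg m \<gamma> < d}. x \<gamma> * xmon m \<gamma> (omega p t))"
    using assms(1) unfolding lowspan_def by blast
  moreover obtain y where "\<forall>t\<in>roots p m. r t = (\<Sum>\<gamma>\<in>{\<gamma> \<in> box p m. deg m \<gamma> < d}. y \<gamma> * xmon m \<gamma> (omega p t))"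
    using assms(2) unfolding lowspan_def by blast
  ultimately show ?thesis
    unfolding lowspan_def
    by (intro CollectI exI[of _ "\<lambda>\<gamma>. x \<gamma> + y \<gamma>"]) (simp add: distrib_right sum.distrib)
qed

lemma lowspan_scale:
  assumes "q \<in> lowspan p m d"
  shows "(\<lambda>t. a * q t) \<in> lowspan p m d"
proof -
  obtain x where "\<forall>t\<in>roots p m. q t = (\<Sum>\<gamma>\<in>{\<gamma> \<in> box p m. deg m \<gamma> < d}. x \<gamma> * xmon m \<gamma> (omega p t))"
    using assms(1) unfolding lowspan_def by blast
  then show ?thesis
    unfolding lowspan_def
    by (intro CollectI exI[of _ "\<lambda>\<gamma>. a * x \<gamma>"]) (simp add: sum_distrib_left mult.assoc)
qed

lemma lowspan_sum: "(\<And>k. k \<in> K \<Longrightarrow> q k \<in> lowspan p m d) \<Longrightarrow> (\<lambda>t. \<Sum>k\<in>K. q k t) \<in> lowspan p m d"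
  by (induction K rule: infinite_finite_induct) (auto intro: lowspan_zero lowspan_add)

lemma lowspan_xmon:
  assumes "p > 0" "deg m \<alpha> < d"
  shows "(\<lambda>t. xmon m \<alpha> (omega p t)) \<in> lowspan p m d"
  unfolding lowspan_def
proof (intro CollectI exI[of _ "\<lambda>\<gamma>. if \<gamma> = red p m \<alpha> then 1 else 0"] ballI)
  fix t
  have "red p m \<alpha> \<in> {\<gamma> \<in> box p m. deg m \<gamma> < d}"
    using red_in_box[OF assms(1)] deg_red_le[of m p \<alpha>] assms(2) by simp
  then have "(\<Sum>\<gamma>\<in>{\<gamma> \<in> box p m. deg m \<gamma> < d}. if \<gamma> = red p m \<alpha> then xmon m \<gamma> (omega p t) else 0)
      = xmon m (red p m \<alpha>) (omega p t)"
    by (subst sum.delta) (auto simp: finite_box)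
  then show "xmon m \<alpha> (omega p t) = (\<Sum>\<gamma>\<in>{\<gamma> \<in> box p m. deg m \<gamma> < d}.
      (if \<gamma> = red p m \<alpha> then 1 else 0) * xmon m \<gamma> (omega p t))"
    by (simp add: xmon_red_omega[OF assms(1)] if_distrib[of "\<lambda>x. x * _"] cong: if_cong)
qed

text \<open>Expanding one factor \<open>lin\<close> raises the degree of the monomial by one, so
  \<open>e + deg m \<alpha>\<close> is constant along the induction.\<close>

lemma lowspan_lin_power_xmon:
  assumes "p > 0" "e + deg m \<alpha> < d"
  shows "(\<lambda>t. lin m z (omega p t) ^ e * xmon m \<alpha> (omega p t)) \<in> lowspan p m d"
  using assms(2)
proof (induction e arbitrary: \<alpha>)
  case 0
  then show ?case using lowspan_xmon[OF assms(1)] by simp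
next
  case (Suc e)
  have "(\<lambda>t. \<Sum>j<m. z j * (lin m z (omega p t) ^ e * xmon m (\<alpha>(j := Suc (\<alpha> j))) (omega p t))) \<in> lowspan p m d"
  proof (intro lowspan_sum lowspan_scale)
    fix j assume "j \<in> {..<m}"
    then show "(\<lambda>t. lin m z (omega p t) ^ e * xmon m (\<alpha>(j := Suc (\<alpha> j))) (omega p t)) \<in> lowspan p m d"
      using Suc.prems by (intro Suc.IH) (simp add: deg_upd_Suc del: fun_upd_apply)
  qed
  also have "(\<lambda>t. \<Sum>j<m. z j * (lin m z (omega p t) ^ e * xmon m (\<alpha>(j := Suc (\<alpha> j))) (omega p t)))
    = (\<lambda>t. lin m z (omega p t) ^ Suc e * xmon m \<alpha> (omega p t))"
  proof
    fix t
    have "(\<Sum>j<m. z j * (lin m z (omega p t) ^ e * xmon m (\<alpha>(j := Suc (\<alpha> j))) (omega p t)))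
      = (\<Sum>j<m. z j * omega p t j * (lin m z (omega p t) ^ e * xmon m \<alpha> (omega p t)))"
      by (intro sum.cong refl) (simp add: xmon_upd_Suc del: fun_upd_apply)
    also have "\<dots> = lin m z (omega p t) * (lin m z (omega p t) ^ e * xmon m \<alpha> (omega p t))"
      by (simp only: lin_def sum_distrib_right)
    finally show "(\<Sum>j<m. z j * (lin m z (omega p t) ^ e * xmon m (\<alpha>(j := Suc (\<alpha> j))) (omega p t)))
      = lin m z (omega p t) ^ Suc e * xmon m \<alpha> (omega p t)"
      by (simp add: mult.assoc)
  qed
  finally show ?case .
qed

section \<open>Homogeneous components on multiples of the tuples\<close>

lemma xmon_scale: "xmon m \<alpha> (\<lambda>i. \<tau> * \<xi> i) = \<tau> ^ deg m \<alpha> * xmon m \<alpha> \<xi>"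
  by (simp add: xmon_def deg_def power_mult_distrib prod.distrib power_sum)

lemma lin_scale: "lin m z (\<lambda>i. \<tau> * \<xi> i) = \<tau> * lin m z \<xi>"
  by (simp add: lin_def sum_distrib_left mult.left_commute)

text \<open>On \<open>\<tau>\<close> times a tuple of roots of unity, the degree \<open>d\<close> component of \<open>G\<close> is \<open>\<tau> ^ d\<close> times
  a multiple of \<open>1 - lin m z\<close> by a function of degree less than \<open>d\<close>.\<close>

definition lin_divisible :: "nat \<Rightarrow> nat \<Rightarrow> (nat \<Rightarrow> complex) \<Rightarrow> ((nat \<Rightarrow> complex) \<Rightarrow> complex) \<Rightarrow> bool" where
  "lin_divisible p m z G \<longleftrightarrow> (\<exists>N q. (\<forall>d. q d \<in> lowspan p m d) \<and> (\<forall>d>N. \<forall>t. q d t = 0) \<and>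
     (\<forall>\<tau>. \<forall>t\<in>roots p m. G (\<lambda>i. \<tau> * omega p t i) =
        (\<Sum>d\<le>N. (1 - lin m z (omega p t)) * q d t * \<tau> ^ d)))"

lemma lin_divisible_zero: "lin_divisible p m z (\<lambda>_. 0)"
  unfolding lin_divisible_def
  by (intro exI[of _ 0] exI[of _ "\<lambda>_ _. 0"]) (auto intro: lowspan_zero)

lemma lin_divisible_add:
  assumes "lin_divisible p m z G" "lin_divisible p m z H"
  shows "lin_divisible p m z (\<lambda>\<xi>. G \<xi> + H \<xi>)"
proof -
  obtain N q where q: "\<And>d. q d \<in> lowspan p m d" "\<And>d t. d > N \<Longrightarrow> q d t = 0"
    "\<And>\<tau> t. t \<in> roots p m \<Longrightarrow> G (\<lambda>i. \<tau> * omega p t i) = (\<Sum>d\<le>N. (1 - lin m z (omega p t)) * q d t * \<tau> ^ d)"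
    using assms(1) unfolding lin_divisible_def by blast
  obtain K r where r: "\<And>d. r d \<in> lowspan p m d" "\<And>d t. d > K \<Longrightarrow> r d t = 0"
    "\<And>\<tau> t. t \<in> roots p m \<Longrightarrow> H (\<lambda>i. \<tau> * omega p t i) = (\<Sum>d\<le>K. (1 - lin m z (omega p t)) * r d t * \<tau> ^ d)"
    using assms(2) unfolding lin_divisible_def by blast
  show ?thesis
    unfolding lin_divisible_def
  proof (intro exI[of _ "max N K"] exI[of _ "\<lambda>d t. q d t + r d t"] conjI allI impI ballI)
    fix \<tau> t assume t: "t \<in> roots p m"
    have "(\<Sum>d\<le>N. (1 - lin m z (omega p t)) * q d t * \<tau> ^ d) = (\<Sum>d\<le>max N K. (1 - lin m z (omega p t)) * q d t * \<tau> ^ d)"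
      by (rule sum.mono_neutral_left) (auto simp: q(2))
    moreover have "(\<Sum>d\<le>K. (1 - lin m z (omega p t)) * r d t * \<tau> ^ d) = (\<Sum>d\<le>max N K. (1 - lin m z (omega p t)) * r d t * \<tau> ^ d)"
      by (rule sum.mono_neutral_left) (auto simp: r(2))
    ultimately show "G (\<lambda>i. \<tau> * omega p t i) + H (\<lambda>i. \<tau> * omega p t i)
      = (\<Sum>d\<le>max N K. (1 - lin m z (omega p t)) * (q d t + r d t) * \<tau> ^ d)"
      by (simp only: q(3)[OF t] r(3)[OF t] distrib_left distrib_right sum.distrib)
  qed (auto simp: q r intro: lowspan_add)
qed

lemma lin_divisible_sum:
  "(\<And>k. k \<in> K \<Longrightarrow> lin_divisible p m z (G k)) \<Longrightarrow> lin_divisible p m z (\<lambda>\<xi>. \<Sum>k\<in>K. G k \<xi>)"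
  by (induction K rule: infinite_finite_induct) (auto intro: lin_divisible_zero lin_divisible_add)

text \<open>With s the value of \<open>lin\<close> at the tuple, \<open>Ltilde\<close> takes the
  value z_k^p \<tau>^p (1 - s^p), which is divisible by 1 - s. The quotient involves powers of s
  below \<open>p\<close>, so the degree stays below \<open>deg m \<alpha> + p\<close>.\<close>

lemma lin_divisible_xmon_Ltilde:
  assumes "p > 0" "k < m"
  shows "lin_divisible p m z (\<lambda>\<xi>. a * xmon m \<alpha> \<xi> * Ltilde p m k z \<xi>)"
  unfolding lin_divisible_def
proof (intro exI conjI allI impI ballI)
  let ?q = "\<lambda>t. a * z k ^ p * (\<Sum>e<p. lin m z (omega p t) ^ e * xmon m \<alpha> (omega p t))"
  let ?n = "deg m \<alpha> + p"
  show "(if d = ?n then ?q else (\<lambda>_. 0)) \<in> lowspan p m d" for d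
    by (auto intro!: lowspan_zero lowspan_scale lowspan_sum lowspan_lin_power_xmon assms)
  show "(if d = ?n then ?q else (\<lambda>_. 0)) t = 0" if "d > ?n" for d t
    using that by simp
  fix \<tau> t
  let ?w = "omega p t"
  let ?s = "lin m z ?w"
  have L: "Ltilde p m k z (\<lambda>i. \<tau> * ?w i) = z k ^ p * \<tau> ^ p * (1 - ?s ^ p)"
    unfolding Ltilde_def lin_def[symmetric] lin_scale
    by (simp add: power_mult_distrib omega_power_p[OF assms(1)] algebra_simps)
  have "a * xmon m \<alpha> (\<lambda>i. \<tau> * ?w i) * Ltilde p m k z (\<lambda>i. \<tau> * ?w i)
      = (1 - ?s) * (a * z k ^ p * ((\<Sum>e<p. ?s ^ e) * xmon m \<alpha> ?w)) * \<tau> ^ ?n"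
    unfolding L one_diff_power_eq by (simp add: xmon_scale power_add mult_ac)
  also have "\<dots> = (1 - ?s) * ?q t * \<tau> ^ ?n"
    by (simp only: sum_distrib_right)
  also have "\<dots> = (\<Sum>d\<le>?n. if d = ?n then (1 - ?s) * ?q t * \<tau> ^ d else 0)"
    by (subst sum.delta) auto
  also have "\<dots> = (\<Sum>d\<le>?n. (1 - ?s) * (if d = ?n then ?q else (\<lambda>_. 0)) t * \<tau> ^ d)"
    by (intro sum.cong) auto
  finally show "a * xmon m \<alpha> (\<lambda>i. \<tau> * ?w i) * Ltilde p m k z (\<lambda>i. \<tau> * ?w i)
      = (\<Sum>d\<le>?n. (1 - ?s) * (if d = ?n then ?q else (\<lambda>_. 0)) t * \<tau> ^ d)" .
qed

lemma (in localization) IdealL_lin_divisible: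
  assumes "G \<in> IdealL p m f" and z: "z \<in> Dom p m f"
  shows "lin_divisible p m z (G z)"
proof -
  obtain H where H: "\<And>k. k < m \<Longrightarrow> H k \<in> PolyOver p m f"
    "\<And>\<xi>. G z \<xi> = (\<Sum>k<m. H k z \<xi> * Ltilde p m k z \<xi>)"
    using assms unfolding IdealL_def by blast
  have "lin_divisible p m z (\<lambda>\<xi>. H k z \<xi> * Ltilde p m k z \<xi>)" if k: "k < m" for k
  proof -
    obtain S c where c: "\<And>\<xi>. H k z \<xi> = (\<Sum>\<beta>\<in>S. c \<beta> z * (\<Prod>i<m. \<xi> i ^ \<beta> i))"
      using PolyOverE[OF H(1)[OF k]] z by metis
    have "lin_divisible p m z (\<lambda>\<xi>. \<Sum>\<beta>\<in>S. c \<beta> z * xmon m \<beta> \<xi> * Ltilde p m k z \<xi>)"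
      by (intro lin_divisible_sum lin_divisible_xmon_Ltilde p_pos k)
    then show ?thesis
      by (simp add: c xmon_def sum_distrib_right)
  qed
  then have "lin_divisible p m z (\<lambda>\<xi>. \<Sum>k<m. H k z \<xi> * Ltilde p m k z \<xi>)"
    by (intro lin_divisible_sum) auto
  then show ?thesis by (simp flip: H(2))
qed

text \<open>At a fixed point, a combination of generators lying in the ideal comes from the
  relations. Compare coefficients of \<tau>^d, replace each power of s = \<open>lin\<close> by 1
  modulo 1 - s, and compare coefficients of box monomials.\<close>

lemma lin_divisible_in_column_space:
  assumes "p > 0" and div: "lin_divisible p m z (\<lambda>\<xi>. \<Sum>i\<in>row_idx p m. c i * hmon m (fst i) (snd i) z \<xi>)"
  obtains x where "\<And>d \<delta>. (d, \<delta>) \<in> row_idx p m \<Longrightarrow>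
    c (d, \<delta>) = (\<Sum>\<gamma>\<in>{\<gamma> \<in> box p m. deg m \<gamma> < d}. mulmat p m z \<delta> \<gamma> * x d \<gamma>)"
proof -
  let ?D = "m * (p - 1)"
  let ?B = "\<lambda>d. {\<beta> \<in> box p m. deg m \<beta> \<le> d}"
  let ?C = "\<lambda>d. {\<beta> \<in> box p m. deg m \<beta> < d}"
  obtain N q where q: "\<And>d. q d \<in> lowspan p m d" "\<And>d t. d > N \<Longrightarrow> q d t = 0"
    "\<And>\<tau> t. t \<in> roots p m \<Longrightarrow> (\<Sum>i\<in>row_idx p m. c i * hmon m (fst i) (snd i) z (\<lambda>i. \<tau> * omega p t i))
       = (\<Sum>d\<le>N. (1 - lin m z (omega p t)) * q d t * \<tau> ^ d)"
    using div unfolding lin_divisible_def by blast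
  define h where "h d t = (\<Sum>\<beta>\<in>?B d. c (d, \<beta>) * (lin m z (omega p t) ^ (d - deg m \<beta>) * xmon m \<beta> (omega p t)))" for d t
  have coeffs: "h d t = (1 - lin m z (omega p t)) * q d t" if t: "t \<in> roots p m" and d: "d \<le> ?D" for d t
  proof -
    \<comment> \<open>Extension by zero gives both polynomials in \<tau> the same degree
      bound.\<close>
    let ?h = "\<lambda>d. if d \<le> ?D then h d t else 0"
    have "(\<Sum>d\<le>max N ?D. ?h d * \<tau> ^ d) = (\<Sum>d\<le>max N ?D. (1 - lin m z (omega p t)) * q d t * \<tau> ^ d)" for \<tau>
    proof -
      have "(\<Sum>d\<le>max N ?D. ?h d * \<tau> ^ d) = (\<Sum>d\<le>?D. h d t * \<tau> ^ d)"
        by (rule sum.mono_neutral_cong_right) auto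
      also have "\<dots> = (\<Sum>d\<le>?D. \<Sum>\<beta>\<in>?B d. c (d, \<beta>) * hmon m d \<beta> z (\<lambda>i. \<tau> * omega p t i))"
      proof (intro sum.cong refl)
        fix d
        have "\<tau> ^ d = \<tau> ^ (d - deg m \<beta>) * \<tau> ^ deg m \<beta>" if "\<beta> \<in> ?B d" for \<beta>
          using that by (simp flip: power_add)
        then show "h d t * \<tau> ^ d = (\<Sum>\<beta>\<in>?B d. c (d, \<beta>) * hmon m d \<beta> z (\<lambda>i. \<tau> * omega p t i))"
          unfolding h_def hmon_def sum_distrib_right
          by (intro sum.cong refl) (simp add: lin_scale xmon_scale power_mult_distrib mult_ac)
      qed
      also have "\<dots> = (\<Sum>i\<in>row_idx p m. c i * hmon m (fst i) (snd i) z (\<lambda>i. \<tau> * omega p t i))"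
        unfolding row_idx_def by (subst sum.Sigma) (auto simp: finite_box intro!: sum.cong)
      also have "\<dots> = (\<Sum>d\<le>N. (1 - lin m z (omega p t)) * q d t * \<tau> ^ d)"
        by (rule q(3)[OF t])
      also have "\<dots> = (\<Sum>d\<le>max N ?D. (1 - lin m z (omega p t)) * q d t * \<tau> ^ d)"
        by (rule sum.mono_neutral_left) (auto simp: q(2))
      finally show ?thesis .
    qed
    then have "\<forall>d\<le>max N ?D. ?h d = (1 - lin m z (omega p t)) * q d t"
      by (intro iffD1[OF polyfun_eq_coeffs[of ?h "max N ?D" "\<lambda>d. (1 - lin m z (omega p t)) * q d t"]] allI)
    moreover have "d \<le> max N ?D" using d by simp
    ultimately have "?h d = (1 - lin m z (omega p t)) * q d t" by blast
    then show ?thesis unfolding if_P[OF d] .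
  qed
  \<comment> \<open>With s = \<open>lin\<close>, this is the sum of \<open>c (d, \<beta>) * (1 - s ^
    (d - deg m \<beta>)) * xmon m \<beta>\<close> divided by 1 - s; its terms have degree below
    \<open>d\<close>.\<close>
  define r where "r d t = (\<Sum>\<beta>\<in>?B d. c (d, \<beta>) * (\<Sum>e<d - deg m \<beta>. lin m z (omega p t) ^ e * xmon m \<beta> (omega p t)))" for d t
  have "(\<lambda>t. q d t + r d t) \<in> lowspan p m d" for d
    unfolding r_def
    by (intro lowspan_add lowspan_sum lowspan_scale lowspan_lin_power_xmon q assms(1)) auto
  then have "\<forall>d. \<exists>x. \<forall>t\<in>roots p m. q d t + r d t = (\<Sum>\<gamma>\<in>?C d. x \<gamma> * xmon m \<gamma> (omega p t))"
    unfolding lowspan_def by blast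
  from choice[OF this] obtain x where x: "\<And>d t. t \<in> roots p m \<Longrightarrow>
      q d t + r d t = (\<Sum>\<gamma>\<in>?C d. x d \<gamma> * xmon m \<gamma> (omega p t))"
    by blast
  have top: "(\<Sum>\<beta>\<in>?B d. c (d, \<beta>) * xmon m \<beta> (omega p t)) = h d t + (1 - lin m z (omega p t)) * r d t" for d t
  proof -
    have "h d t + (1 - lin m z (omega p t)) * r d t = (\<Sum>\<beta>\<in>?B d. c (d, \<beta>) * xmon m \<beta> (omega p t) *
        (lin m z (omega p t) ^ (d - deg m \<beta>) + (1 - lin m z (omega p t)) * (\<Sum>e<d - deg m \<beta>. lin m z (omega p t) ^ e)))"
      unfolding h_def r_def sum_distrib_left sum.distrib[symmetric]
      by (intro sum.cong refl) (simp add: sum_distrib_left algebra_simps)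
    then show ?thesis by (simp only: one_diff_power_eq[symmetric]) simp
  qed
  show ?thesis
  proof (rule that[of x])
    fix d \<delta> assume "(d, \<delta>) \<in> row_idx p m"
    then have d: "d \<le> ?D" and \<delta>: "\<delta> \<in> box p m" "deg m \<delta> \<le> d"
      by (auto simp: row_idx_def)
    \<comment> \<open>Extension by zero to the whole box, where monomials are independent.\<close>
    let ?c = "\<lambda>\<beta>. if deg m \<beta> \<le> d then c (d, \<beta>) else 0"
    have "?c \<delta> = (\<Sum>\<gamma>\<in>?C d. mulmat p m z \<delta> \<gamma> * x d \<gamma>)"
    proof (rule xmon_omega_independent[OF assms(1) _ \<delta>(1)])
      fix t assume t: "t \<in> roots p m"
      have "(\<Sum>\<beta>\<in>box p m. ?c \<beta> * xmon m \<beta> (omega p t)) = (\<Sum>\<beta>\<in>?B d. c (d, \<beta>) * xmon m \<beta> (omega p t))"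
        by (rule sum.mono_neutral_cong_right) (auto simp: finite_box)
      also have "\<dots> = (1 - lin m z (omega p t)) * (q d t + r d t)"
        unfolding top coeffs[OF t d] by (simp add: algebra_simps)
      also have "\<dots> = (\<Sum>\<gamma>\<in>?C d. x d \<gamma> * ((1 - lin m z (omega p t)) * xmon m \<gamma> (omega p t)))"
        unfolding x[OF t] sum_distrib_left by (simp add: mult_ac)
      also have "\<dots> = (\<Sum>\<gamma>\<in>?C d. x d \<gamma> * (\<Sum>\<beta>\<in>box p m. mulmat p m z \<beta> \<gamma> * xmon m \<beta> (omega p t)))"
        by (intro sum.cong refl) (simp add: sum_mulmat_xmon[OF assms(1)])
      also have "\<dots> = (\<Sum>\<beta>\<in>box p m. (\<Sum>\<gamma>\<in>?C d. mulmat p m z \<beta> \<gamma> * x d \<gamma>) * xmon m \<beta> (omega p t))"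
        unfolding sum_distrib_left sum_distrib_right by (subst sum.swap) (simp add: mult_ac)
      finally show "(\<Sum>\<beta>\<in>box p m. ?c \<beta> * xmon m \<beta> (omega p t))
        = (\<Sum>\<beta>\<in>box p m. (\<Sum>\<gamma>\<in>?C d. mulmat p m z \<beta> \<gamma> * x d \<gamma>) * xmon m \<beta> (omega p t))" .
    qed
    with \<delta>(2) show "c (d, \<delta>) = (\<Sum>\<gamma>\<in>?C d. mulmat p m z \<delta> \<gamma> * x d \<gamma>)" by simp
  qed
qed

section \<open>Local bases\<close>

text \<open>The quotient is the cokernel of this matrix, with rows indexed by \<^const>\<open>row_idx\<close> and columns by
  \<^const>\<open>col_idx\<close>.\<close>

definition relmat :: "nat \<Rightarrow> nat \<Rightarrow> (nat \<Rightarrow> complex) \<Rightarrow> nat \<times> (nat \<Rightarrow> nat) \<Rightarrow> nat \<times> (nat \<Rightarrow> nat) \<Rightarrow> complex" where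
  "relmat p m z i j = (if fst i = fst j then mulmat p m z (snd i) (snd j) else 0)"

text \<open>The left inverse \<psi>: block diagonal, with one truncated block of
  \<open>mulinv\<close> per degree.\<close>

definition relinv :: "nat \<Rightarrow> nat \<Rightarrow> (nat \<Rightarrow> complex) \<Rightarrow> nat \<times> (nat \<Rightarrow> nat) \<Rightarrow> nat \<times> (nat \<Rightarrow> nat) \<Rightarrow> complex" where
  "relinv p m z j i = (if fst j = fst i then mulinv p m z (snd j) (snd i) else 0)"

lemma poly_fun_relmat: "poly_fun m (\<lambda>z. relmat p m z i j)"
  unfolding relmat_def by (cases "fst i = fst j") (auto intro: poly_fun_mulmat poly_fun_const)

lemma sum_row_idx:
  assumes "d \<le> m * (p - 1)"
  shows "(\<Sum>i\<in>row_idx p m. if fst i = d then F (snd i) else 0) = (\<Sum>\<beta>\<in>{\<beta> \<in> box p m. deg m \<beta> \<le> d}. F \<beta>)"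
proof -
  have "(\<Sum>i\<in>row_idx p m. if fst i = d then F (snd i) else 0)
    = (\<Sum>e\<le>m * (p - 1). \<Sum>\<beta>\<in>{\<beta> \<in> box p m. deg m \<beta> \<le> e}. if e = d then F \<beta> else 0)"
    unfolding row_idx_def by (subst sum.Sigma) (auto simp: finite_box intro!: sum.cong)
  also have "\<dots> = (\<Sum>e\<le>m * (p - 1). if e = d then \<Sum>\<beta>\<in>{\<beta> \<in> box p m. deg m \<beta> \<le> e}. F \<beta> else 0)"
    by (intro sum.cong) auto
  finally show ?thesis using assms by simp
qed

lemma sum_col_idx:
  assumes "d \<le> m * (p - 1)"
  shows "(\<Sum>i\<in>col_idx p m. if fst i = d then F (snd i) else 0) = (\<Sum>\<beta>\<in>{\<beta> \<in> box p m. deg m \<beta> < d}. F \<beta>)"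
proof -
  have "(\<Sum>i\<in>col_idx p m. if fst i = d then F (snd i) else 0)
    = (\<Sum>e\<le>m * (p - 1). \<Sum>\<beta>\<in>{\<beta> \<in> box p m. deg m \<beta> < e}. if e = d then F \<beta> else 0)"
    unfolding col_idx_def by (subst sum.Sigma) (auto simp: finite_box intro!: sum.cong)
  also have "\<dots> = (\<Sum>e\<le>m * (p - 1). if e = d then \<Sum>\<beta>\<in>{\<beta> \<in> box p m. deg m \<beta> < e}. F \<beta> else 0)"
    by (intro sum.cong) auto
  finally show ?thesis using assms by simp
qed

text \<open>Different degrees do not interact. Within one degree \<open>mulmat\<close> vanishes on
  the omitted rows, so the truncated sum equals the full one.\<close>

lemma relinv_relmat:
  assumes "p > 0" "j \<in> col_idx p m" "k \<in> col_idx p m" and z: "Rpoly p m z \<noteq> 0"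
  shows "(\<Sum>i\<in>row_idx p m. relinv p m z j i * relmat p m z i k) = (if j = k then 1 else 0)"
proof -
  obtain d \<beta> where j: "j = (d, \<beta>)" "d \<le> m * (p - 1)" "\<beta> \<in> box p m"
    using assms(2) by (auto simp: col_idx_def)
  obtain e \<gamma> where k: "k = (e, \<gamma>)" "\<gamma> \<in> box p m" "deg m \<gamma> < e"
    using assms(3) by (auto simp: col_idx_def)
  have "(\<Sum>i\<in>row_idx p m. relinv p m z j i * relmat p m z i k)
    = (\<Sum>i\<in>row_idx p m. if fst i = d then (if d = e then mulinv p m z \<beta> (snd i) * mulmat p m z (snd i) \<gamma> else 0) else 0)"
    by (intro sum.cong) (auto simp: relinv_def relmat_def j k)
  also have "\<dots> = (\<Sum>\<delta>\<in>{\<delta> \<in> box p m. deg m \<delta> \<le> d}. if d = e then mulinv p m z \<beta> \<delta> * mulmat p m z \<delta> \<gamma> else 0)"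
    by (rule sum_row_idx[OF j(2)])
  also have "\<dots> = (\<Sum>\<delta>\<in>box p m. if d = e then mulinv p m z \<beta> \<delta> * mulmat p m z \<delta> \<gamma> else 0)"
    by (rule sum.mono_neutral_left) (use k(3) in \<open>auto simp: finite_box mulmat_eq_0\<close>)
  also have "\<dots> = (if j = k then 1 else 0)"
    using mulinv_mulmat[OF assms(1) j(3) k(2) z] by (cases "d = e") (auto simp: j k)
  finally show ?thesis .
qed

section \<open>Adjugates and determinants of products\<close>

lemma sum_mult_adj_mat:
  fixes F :: "nat \<Rightarrow> nat \<Rightarrow> 'a :: comm_ring_1"
  assumes "i < n" "j < n"
  shows "(\<Sum>k<n. F i k * adj_mat (mat n n (\<lambda>(i,j). F i j)) $$ (k, j)) = (if i = j then det (mat n n (\<lambda>(i,j). F i j)) else 0)"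
    and "(\<Sum>k<n. adj_mat (mat n n (\<lambda>(i,j). F i j)) $$ (i, k) * F k j) = (if i = j then det (mat n n (\<lambda>(i,j). F i j)) else 0)"
proof -
  let ?A = "mat n n (\<lambda>(i,j). F i j)"
  have A: "?A \<in> carrier_mat n n" by simp
  note adj = adj_mat[OF A]
  have "(\<Sum>k<n. F i k * adj_mat ?A $$ (k, j)) = (?A * adj_mat ?A) $$ (i, j)"
    using assms adj(1) by (simp add: scalar_prod_def atLeast0LessThan)
  then show "(\<Sum>k<n. F i k * adj_mat ?A $$ (k, j)) = (if i = j then det ?A else 0)"
    unfolding adj(2) using assms by simp
  have "(\<Sum>k<n. adj_mat ?A $$ (i, k) * F k j) = (adj_mat ?A * ?A) $$ (i, j)"
    using assms adj(1) by (simp add: scalar_prod_def atLeast0LessThan)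
  then show "(\<Sum>k<n. adj_mat ?A $$ (i, k) * F k j) = (if i = j then det ?A else 0)"
    unfolding adj(3) using assms by simp
qed

text \<open>Expanding the determinant of a product along the rows of the first factor; a version of the
  Cauchy-Binet formula in which equal minors are not collected.\<close>

lemma det_product_expansion:
  fixes P :: "nat \<Rightarrow> 'b \<Rightarrow> 'a :: comm_ring_1"
  assumes "finite I"
  shows "det (mat n n (\<lambda>(k,l). \<Sum>i\<in>I. P k i * Q i l))
    = (\<Sum>g\<in>PiE {..<n} (\<lambda>_. I). (\<Prod>k<n. P k (g k)) * det (mat n n (\<lambda>(k,l). Q (g k) l)))"
proof -
  let ?S = "{\<pi>. \<pi> permutes {0..<n}}"
  have "det (mat n n (\<lambda>(k,l). \<Sum>i\<in>I. P k i * Q i l)) = (\<Sum>\<pi>\<in>?S. signof \<pi> * (\<Prod>k<n. \<Sum>i\<in>I. P k i * Q i (\<pi> k)))"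
    by (auto simp: det_def atLeast0LessThan permutes_in_image[where S = "{..<n}", simplified]
        intro!: sum.cong prod.cong)
  also have "\<dots> = (\<Sum>\<pi>\<in>?S. \<Sum>g\<in>PiE {..<n} (\<lambda>_. I). signof \<pi> * (\<Prod>k<n. P k (g k) * Q (g k) (\<pi> k)))"
    using assms by (simp add: prod_sum_PiE sum_distrib_left)
  also have "\<dots> = (\<Sum>g\<in>PiE {..<n} (\<lambda>_. I). (\<Prod>k<n. P k (g k)) * (\<Sum>\<pi>\<in>?S. signof \<pi> * (\<Prod>k<n. Q (g k) (\<pi> k))))"
    by (subst sum.swap) (simp add: prod.distrib sum_distrib_left mult_ac)
  also have "\<dots> = (\<Sum>g\<in>PiE {..<n} (\<lambda>_. I). (\<Prod>k<n. P k (g k)) * det (mat n n (\<lambda>(k,l). Q (g k) l)))"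
    by (auto simp: det_def atLeast0LessThan permutes_in_image[where S = "{..<n}", simplified]
        intro!: sum.cong prod.cong arg_cong2[of _ _ _ _ times])
  finally show ?thesis .
qed

lemma poly_fun_det:
  assumes "\<And>i j. poly_fun m (F i j)"
  shows "poly_fun m (\<lambda>z. det (mat n n (\<lambda>(i,j). F i j z)))"
proof -
  have "det (mat n n (\<lambda>(i,j). F i j z)) = (\<Sum>\<pi>\<in>{\<pi>. \<pi> permutes {0..<n}}. signof \<pi> * (\<Prod>i=0..<n. F i (\<pi> i) z))" for z
    by (auto simp: det_def permutes_in_image[where S = "{0..<n}", simplified] intro!: sum.cong prod.cong)
  then show ?thesis
    by (simp only:) (intro poly_fun_sum poly_fun_mult poly_fun_const poly_fun_prod assms)
qed

section \<open>Bases where a maximal minor is inverted\<close>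

locale minor_localization = localization +
  fixes e :: "nat \<Rightarrow> nat \<times> (nat \<Rightarrow> nat)" and a :: nat and g :: "nat \<Rightarrow> nat \<times> (nat \<Rightarrow> nat)"
  assumes e: "bij_betw e {..<a} (col_idx p m)"
    and g: "g ` {..<a} \<subseteq> row_idx p m"
    and f: "f = (\<lambda>z. det (mat a a (\<lambda>(k,l). relmat p m z (g k) (e l))))"
begin

abbreviation adj :: "(nat \<Rightarrow> complex) \<Rightarrow> nat \<Rightarrow> nat \<Rightarrow> complex" where
  "adj z k l \<equiv> adj_mat (mat a a (\<lambda>(k,l). relmat p m z (g k) (e l))) $$ (k, l)"

text \<open>A repeated row makes the minor \<open>f\<close> vanish, so one point of the domain is
  enough.\<close>

lemma inj_on_g:
  assumes "z \<in> Dom p m f"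
  shows "inj_on g {..<a}"
proof (rule inj_onI, rule ccontr)
  fix k l assume kl: "k \<in> {..<a}" "l \<in> {..<a}" "g k = g l" "k \<noteq> l"
  let ?A = "mat a a (\<lambda>(k,l). relmat p m z (g k) (e l))"
  have "det ?A = 0"
    by (rule det_identical_rows[of ?A a k l]) (use kl in \<open>auto intro!: eq_vecI\<close>)
  with assms show False by (simp add: Dom_def f)
qed

lemma relation_in_ideal:
  assumes "j \<in> col_idx p m"
  shows "(\<lambda>z \<xi>. \<Sum>i\<in>row_idx p m. relmat p m z i j * hmon m (fst i) (snd i) z \<xi>) \<in> IdealL p m f"
proof -
  obtain d \<gamma> where j: "j = (d, \<gamma>)" "d \<le> m * (p - 1)" "\<gamma> \<in> box p m" "deg m \<gamma> < d"
    using assms by (auto simp: col_idx_def)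
  have "(\<Sum>i\<in>row_idx p m. relmat p m z i j * hmon m (fst i) (snd i) z \<xi>)
    = (\<Sum>\<delta>\<in>box p m. mulmat p m z \<delta> \<gamma> * hmon m d \<delta> z \<xi>)" for z \<xi>
  proof -
    have "(\<Sum>i\<in>row_idx p m. relmat p m z i j * hmon m (fst i) (snd i) z \<xi>)
      = (\<Sum>i\<in>row_idx p m. if fst i = d then mulmat p m z (snd i) \<gamma> * hmon m d (snd i) z \<xi> else 0)"
      by (intro sum.cong) (auto simp: relmat_def j)
    also have "\<dots> = (\<Sum>\<delta>\<in>{\<delta> \<in> box p m. deg m \<delta> \<le> d}. mulmat p m z \<delta> \<gamma> * hmon m d \<delta> z \<xi>)"
      by (rule sum_row_idx[OF j(2)])
    also have "\<dots> = (\<Sum>\<delta>\<in>box p m. mulmat p m z \<delta> \<gamma> * hmon m d \<delta> z \<xi>)"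
      by (rule sum.mono_neutral_left) (use j(4) in \<open>auto simp: finite_box mulmat_eq_0\<close>)
    finally show ?thesis .
  qed
  with column_in_ideal[OF j(3,4)] show ?thesis by simp
qed

text \<open>Cramer's rule: with the minor inverted, subtracting a combination of relations clears
  the coefficients on its rows.\<close>

lemma spanning_off_minor:
  assumes G: "G \<in> PolyOver p m f"
  obtains c where "\<And>i. i \<in> row_idx p m \<Longrightarrow> c i \<in> LocRing p m f"
    "G \<approx> (\<lambda>z \<xi>. \<Sum>i\<in>row_idx p m - g ` {..<a}. c i z * hmon m (fst i) (snd i) z \<xi>)"
proof -
  obtain b where b: "\<And>i. b i \<in> LocRing p m f"
    and Gb: "G \<approx> (\<lambda>z \<xi>. \<Sum>i\<in>row_idx p m. b i z * hmon m (fst i) (snd i) z \<xi>)"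
    using hmon_spanning[OF G] by blast
  \<comment> \<open>The inverse of the minor, adjugate over determinant, applied to the coefficients
    to be cleared.\<close>
  define w where "w l z = (\<Sum>k<a. adj z l k * (1 / f z) * b (g k) z)" for l z
  have w: "w l \<in> LocRing p m f" if "l < a" for l
    unfolding w_def[abs_def] using that
    by (intro LocRing_sum LocRing_mult LocRing_adj_mat LocRing_inverse_f b LocRing_poly poly_fun_relmat) auto
  define c where "c i z = b i z - (\<Sum>l<a. w l z * relmat p m z i (e l))" for i z
  have c: "c i \<in> LocRing p m f" for i
    unfolding c_def[abs_def] by (intro LocRing_diff LocRing_sum LocRing_mult b w LocRing_poly poly_fun_relmat) auto
  have c_0: "c (g k) z = 0" if "k < a" and z: "z \<in> Dom p m f" for k z
  proof -
    have "(\<Sum>l<a. w l z * relmat p m z (g k) (e l))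
      = (\<Sum>k'<a. (\<Sum>l<a. relmat p m z (g k) (e l) * adj z l k') * (1 / f z) * b (g k') z)"
      unfolding w_def sum_distrib_right by (subst sum.swap) (simp add: mult_ac)
    also have "\<dots> = (\<Sum>k'<a. if k' = k then b (g k') z else 0)"
      using z that(1) sum_mult_adj_mat(1)[of k a _ "\<lambda>k l. relmat p m z (g k) (e l)"]
      by (intro sum.cong refl) (auto simp: Dom_def f)
    finally show ?thesis using that(1) by (simp add: c_def)
  qed
  have "(\<lambda>z \<xi>. \<Sum>l<a. w l z * (\<Sum>i\<in>row_idx p m. relmat p m z i (e l) * hmon m (fst i) (snd i) z \<xi>)) \<in> IdealL p m f"
    using bij_betwE[OF e] by (intro IdealL_sum IdealL_coeff_mult w relation_in_ideal) auto
  from IdealL_add[OF Gb[unfolded ideal_cong_def] this]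
  have "G \<approx> (\<lambda>z \<xi>. \<Sum>i\<in>row_idx p m - g ` {..<a}. c i z * hmon m (fst i) (snd i) z \<xi>)"
    unfolding ideal_cong_def
  proof (rule IdealL_cong)
    fix z \<xi> assume z: "z \<in> Dom p m f"
    have "(\<Sum>i\<in>row_idx p m - g ` {..<a}. c i z * hmon m (fst i) (snd i) z \<xi>)
      = (\<Sum>i\<in>row_idx p m. c i z * hmon m (fst i) (snd i) z \<xi>)"
      by (rule sum.mono_neutral_left) (auto simp: finite_row_idx c_0[OF _ z])
    also have "\<dots> = (\<Sum>i\<in>row_idx p m. b i z * hmon m (fst i) (snd i) z \<xi>)
       - (\<Sum>l<a. w l z * (\<Sum>i\<in>row_idx p m. relmat p m z i (e l) * hmon m (fst i) (snd i) z \<xi>))"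
      unfolding c_def left_diff_distrib sum_subtractf sum_distrib_left sum_distrib_right
      by (subst sum.swap) (simp add: mult_ac)
    finally show "G z \<xi> - (\<Sum>i\<in>row_idx p m - g ` {..<a}. c i z * hmon m (fst i) (snd i) z \<xi>)
      = G z \<xi> - (\<Sum>i\<in>row_idx p m. b i z * hmon m (fst i) (snd i) z \<xi>)
       + (\<Sum>l<a. w l z * (\<Sum>i\<in>row_idx p m. relmat p m z i (e l) * hmon m (fst i) (snd i) z \<xi>))"
      by simp
  qed
  with c that show ?thesis by blast
qed

text \<open>At \<open>z\<close> the coefficients, extended by zero, form a combination
  \<open>X\<close> of the columns of \<open>relmat\<close>. They vanish on the rows of the
  invertible minor, which forces \<open>X\<close> to be zero.\<close>

lemma independent_off_minor:
  assumes c: "(\<lambda>z \<xi>. \<Sum>i\<in>row_idx p m - g ` {..<a}. c i z * hmon m (fst i) (snd i) z \<xi>) \<in> IdealL p m f"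
    and z: "z \<in> Dom p m f" and i: "i \<in> row_idx p m - g ` {..<a}"
  shows "c i z = 0"
proof -
  define C where "C i = (if i \<in> g ` {..<a} then 0 else c i z)" for i
  have "(\<Sum>i\<in>row_idx p m - g ` {..<a}. c i z * hmon m (fst i) (snd i) z \<xi>)
      = (\<Sum>i\<in>row_idx p m. C i * hmon m (fst i) (snd i) z \<xi>)" for \<xi>
    by (rule sum.mono_neutral_cong_left) (auto simp: finite_row_idx C_def)
  with IdealL_lin_divisible[OF c z]
  have "lin_divisible p m z (\<lambda>\<xi>. \<Sum>i\<in>row_idx p m. C i * hmon m (fst i) (snd i) z \<xi>)"
    by simp
  then obtain x where x: "\<And>d \<delta>. (d, \<delta>) \<in> row_idx p m \<Longrightarrow>
      C (d, \<delta>) = (\<Sum>\<gamma>\<in>{\<gamma> \<in> box p m. deg m \<gamma> < d}. mulmat p m z \<delta> \<gamma> * x d \<gamma>)"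
    using lin_divisible_in_column_space[OF p_pos] by blast
  define X where "X l = x (fst (e l)) (snd (e l))" for l
  have C: "C i = (\<Sum>l<a. relmat p m z i (e l) * X l)" if i_row: "i \<in> row_idx p m" for i
  proof -
    obtain d \<delta> where i: "i = (d, \<delta>)" "d \<le> m * (p - 1)"
      using i_row by (auto simp: row_idx_def)
    have "(\<Sum>l<a. relmat p m z i (e l) * X l) = (\<Sum>j\<in>col_idx p m. relmat p m z i j * x (fst j) (snd j))"
      unfolding X_def by (rule sum.reindex_bij_betw[OF e])
    also have "\<dots> = (\<Sum>j\<in>col_idx p m. if fst j = d then mulmat p m z \<delta> (snd j) * x d (snd j) else 0)"
      by (intro sum.cong) (auto simp: relmat_def i)
    also have "\<dots> = C i"
      using x i_row sum_col_idx[OF i(2), of "\<lambda>\<gamma>. mulmat p m z \<delta> \<gamma> * x d \<gamma>"] by (simp add: i)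
    finally show ?thesis by simp
  qed
  have "X l = 0" if l: "l < a" for l
  proof -
    have "f z * X l = (\<Sum>l'<a. (\<Sum>k<a. adj z l k * relmat p m z (g k) (e l')) * X l')"
    proof -
      have "(\<Sum>l'<a. (\<Sum>k<a. adj z l k * relmat p m z (g k) (e l')) * X l')
        = (\<Sum>l'<a. if l' = l then f z * X l' else 0)"
        using l sum_mult_adj_mat(2)[of l a _ "\<lambda>k l. relmat p m z (g k) (e l)"]
        by (intro sum.cong refl) (auto simp: f)
      then show ?thesis using l by simp
    qed
    also have "\<dots> = (\<Sum>k<a. adj z l k * (\<Sum>l'<a. relmat p m z (g k) (e l') * X l'))"
      unfolding sum_distrib_left sum_distrib_right by (subst sum.swap) (simp add: mult_ac)
    also have "\<dots> = (\<Sum>k<a. adj z l k * C (g k))"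
      using g by (intro sum.cong refl) (auto simp: C)
    also have "\<dots> = 0" by (simp add: C_def)
    finally show ?thesis using z by (simp add: Dom_def)
  qed
  then have "C i = 0" using i C by simp
  with i show ?thesis by (simp add: C_def)
qed

lemma free_quotient: "free_quotient_rank p m f (p ^ m)"
proof (cases "Dom p m f = {}")
  \<comment> \<open>If the minor vanishes on the whole base, as it does when \<open>g\<close>
    repeats a row, every function lies in the ideal and independence is vacuous; zero vectors serve
    as a basis.\<close>
  case True
  then have "G \<in> IdealL p m f" for G
    using IdealL_cong[OF IdealL_zero] by blast
  then show ?thesis
    unfolding free_quotient_rank_def using True LocRing_const[of 0] PolyOver_coeff[OF LocRing_const[of 0]]
    by (intro exI[of _ "\<lambda>_ _ _. 0"]) auto
next
  case False
  let ?R = "row_idx p m - g ` {..<a}"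
  have "card (g ` {..<a}) = card (col_idx p m)"
    using False inj_on_g bij_betw_same_card[OF e] by (auto simp: card_image)
  then have "card ?R = p ^ m"
    using g finite_subset[OF g finite_row_idx] by (simp add: card_Diff_subset card_row_idx)
  then obtain h where h: "bij_betw h {..<p ^ m} ?R"
    using ex_bij_betw_nat_finite[of ?R] finite_row_idx by (auto simp: atLeast0LessThan)
  have reindex: "(\<Sum>j<p ^ m. c (h j) z * hmon m (fst (h j)) (snd (h j)) z \<xi>)
      = (\<Sum>i\<in>?R. c i z * hmon m (fst i) (snd i) z \<xi>)" for c :: "nat \<times> (nat \<Rightarrow> nat) \<Rightarrow> (nat \<Rightarrow> complex) \<Rightarrow> complex" and z \<xi>
    by (rule sum.reindex_bij_betw[OF h])
  have h_in: "h j \<in> ?R" if "j < p ^ m" for j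
    using bij_betwE[OF h] that by blast
  show ?thesis
    unfolding free_quotient_rank_def
  proof (intro exI[of _ "\<lambda>j. hmon m (fst (h j)) (snd (h j))"] conjI allI impI ballI)
    show "hmon m (fst (h j)) (snd (h j)) \<in> PolyOver p m f" for j
      by (rule PolyOver_hmon)
  next
    fix G assume "G \<in> PolyOver p m f"
    then obtain c where c: "\<And>i. i \<in> row_idx p m \<Longrightarrow> c i \<in> LocRing p m f"
      "G \<approx> (\<lambda>z \<xi>. \<Sum>i\<in>?R. c i z * hmon m (fst i) (snd i) z \<xi>)"
      using spanning_off_minor by blast
    then show "\<exists>c. (\<forall>j<p ^ m. c j \<in> LocRing p m f) \<and>
        (\<lambda>z \<xi>. G z \<xi> - (\<Sum>j<p ^ m. c j z * hmon m (fst (h j)) (snd (h j)) z \<xi>)) \<in> IdealL p m f"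
      using h_in by (intro exI[of _ "\<lambda>j. c (h j)"]) (auto simp: reindex ideal_cong_def)
  next
    fix c j z
    assume c: "(\<forall>j<p ^ m. c j \<in> LocRing p m f) \<and>
        (\<lambda>z \<xi>. \<Sum>j<p ^ m. c j z * hmon m (fst (h j)) (snd (h j)) z \<xi>) \<in> IdealL p m f"
      and j: "j < p ^ m" and z: "z \<in> Dom p m f"
    \<comment> \<open>Coefficients numbered by \<open>j\<close> are carried over to the rows outside
      the minor.\<close>
    define c' where "c' i = c (the_inv_into {..<p ^ m} h i)" for i
    have c': "c' (h j) = c j" if "j < p ^ m" for j
      unfolding c'_def using h that by (simp add: the_inv_into_f_f bij_betw_def)
    have "(\<Sum>j<p ^ m. c j z * hmon m (fst (h j)) (snd (h j)) z \<xi>)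
        = (\<Sum>i\<in>?R. c' i z * hmon m (fst i) (snd i) z \<xi>)" for z \<xi>
      unfolding reindex[symmetric] by (intro sum.cong) (auto simp: c')
    with c have "(\<lambda>z \<xi>. \<Sum>i\<in>?R. c' i z * hmon m (fst i) (snd i) z \<xi>) \<in> IdealL p m f"
      by simp
    from independent_off_minor[OF this z h_in[OF j]] show "c j z = 0"
      by (simp add: c'[OF j])
  qed
qed

end

section \<open>The maximal minors generate the unit ideal\<close>

theorem mainTheorem7:
  fixes p m :: nat
  assumes "p \<ge> 2" and "m \<ge> 1"
  shows "locally_free_rank p m (p ^ m)"
proof -
  have p: "p > 0" using assms by simp
  interpret A: localization p m "\<lambda>_. 1"
    by unfold_locales (auto intro: p poly_fun_const)
  define a where "a = card (col_idx p m)"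
  obtain e where e: "bij_betw e {..<a} (col_idx p m)"
    using ex_bij_betw_nat_finite[OF finite_col_idx] by (auto simp: atLeast0LessThan a_def)
  \<comment> \<open>\<open>?F g\<close> is the minor on the rows \<open>g\<close>, and
    \<open>?P g\<close> its coefficient in the expansion of the determinant of the product of
    \<open>relinv\<close> and \<open>relmat\<close>.\<close>
  let ?F = "\<lambda>g z. det (mat a a (\<lambda>(k,l). relmat p m z (g k) (e l)))"
  let ?P = "\<lambda>g z. \<Prod>k<a. relinv p m z (e k) (g k)"
  \<comment> \<open>Maps that repeat a row are included; their minors are zero, which
    \<open>free_quotient\<close> allows.\<close>
  define T where "T = PiE {..<a} (\<lambda>_. row_idx p m)"
  have "finite T"
    unfolding T_def by (intro finite_PiE finite_row_idx) auto
  then obtain h where h: "bij_betw h {..<card T} T"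
    using ex_bij_betw_nat_finite[of T] by (auto simp: atLeast0LessThan)
  have poly_F: "poly_fun m (?F g)" for g
    by (intro poly_fun_det poly_fun_relmat)
  have relinv: "(\<lambda>z. relinv p m z j i) \<in> RingA p m" for i j
    unfolding relinv_def by (cases "fst j = fst i") (auto intro: A.LocRing_mulinv A.LocRing_const)
  show ?thesis
    unfolding locally_free_rank_def
  proof (rule exI[of _ "card T"], rule exI[of _ "\<lambda>i. ?F (h i)"], rule exI[of _ "\<lambda>i. ?P (h i)"],
      intro conjI allI impI ballI)
    show "?F (h i) \<in> RingA p m" for i
      by (intro A.LocRing_poly poly_F)
    show "?P (h i) \<in> RingA p m" for i
      by (intro A.LocRing_prod relinv)
  next
    fix z assume "z \<in> Dom p m (\<lambda>_. 1)"
    then have R: "Rpoly p m z \<noteq> 0" by (simp add: Dom_def)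
    have "(\<Sum>i<card T. ?P (h i) z * ?F (h i) z) = (\<Sum>g\<in>T. ?P g z * ?F g z)"
      by (rule sum.reindex_bij_betw[OF h])
    also have "\<dots> = det (mat a a (\<lambda>(k,l). \<Sum>i\<in>row_idx p m. relinv p m z (e k) i * relmat p m z i (e l)))"
      unfolding T_def by (rule det_product_expansion[OF finite_row_idx, symmetric])
    also have "mat a a (\<lambda>(k,l). \<Sum>i\<in>row_idx p m. relinv p m z (e k) i * relmat p m z i (e l)) = 1\<^sub>m a"
    proof (rule eq_matI)
      fix k l assume "k < dim_row (1\<^sub>m a :: complex mat)" "l < dim_col (1\<^sub>m a :: complex mat)"
      then have kl: "k < a" "l < a" by simp_all
      have "e k = e l \<longleftrightarrow> k = l"
        using bij_betw_imp_inj_on[OF e] kl by (auto dest: inj_onD)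
      moreover have "e k \<in> col_idx p m" "e l \<in> col_idx p m"
        using bij_betwE[OF e] kl by auto
      ultimately show "mat a a (\<lambda>(k,l). \<Sum>i\<in>row_idx p m. relinv p m z (e k) i * relmat p m z i (e l)) $$ (k, l)
        = 1\<^sub>m a $$ (k, l)"
        using kl by (simp add: relinv_relmat[OF p _ _ R])
    qed simp_all
    finally show "(\<Sum>i<card T. ?P (h i) z * ?F (h i) z) = 1" by simp
  next
    fix i assume "i < card T"
    then have "h i \<in> T" using bij_betwE[OF h] by auto
    then interpret minor_localization p m "?F (h i)" e a "h i"
      by unfold_locales (use p e poly_F in \<open>auto simp: T_def\<close>)
    show "free_quotient_rank p m (?F (h i)) (p ^ m)"
      by (rule free_quotient)
  qed
qed

end
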